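(* Let $s \geq 2$. For each $i \in \{1,\dots,s\}$ let $h_i \geq 1$ and let $q_{i,1},\dots,q_{i,h_i} \geq 2$ be integers, such that $\gcd(q_{i,k},q_{j,l})=1$ whenever $i \neq j$. For each $i$ let $\mathcal{P}_i=(p_{i,1},p_{i,2},\dots)$ be an arbitrary sequence with $p_{i,j} \in \{q_{i,1},\dots,q_{i,h_i}\}$ for all $j \geq 1$, and let $\Sigma_i=(\sigma_{i,j})_{j\ge1}$ be an arbitrary sequence where each $\sigma_{i,j}$ is a permutation of $\{0,1,\dots,p_{i,j}-1\}$. Let $H_{\boldsymbol{\mathcal{P}}}^{\mathbf{S}}(n,\mathbf{x})$ denote the generalized Halton sequence defined in the context. Put $h_0=\max_i h_i$, $q_0=\max_{i,j} q_{i,j}$, $C_1 = 2s h_0 q_0^{s}\log_2 q_0$ and $C = 2^{s+3} s^s h_0^s q_0^{s^2}\log_2^s q_0$. Then for every integer $N$ with $\log_2 N \geq 2 q_0^{s-1} C_1$, $$\inf_{\mathbf{x}\in[0,1)^s}\ \max_{1\le M\le N} M\, D^{*}\big((H_{\boldsymbol{\mathcal{P}}}^{\mathbf{S}}(n,\mathbf{x}))_{n=1}^{M}\big) \;\geq\; C^{-1}\log_2^s N .$$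
   Context: Star discrepancy: for points $\beta_1,\dots,\beta_N \in [0,1)^s$ and $\mathbf{y}=(y_1,\dots,y_s)\in(0,1]^s$, let $B_{\mathbf{y}}=[0,y_1)\times\cdots\times[0,y_s)$ and $\Delta(B_{\mathbf{y}},(\beta_n)_{n=1}^N)=\sum_{n=1}^N(\mathbf{1}_{B_{\mathbf{y}}}(\beta_n)-y_1\cdots y_s)$; then $D^*((\beta_n)_{n=1}^N)=\sup_{0<y_1,\dots,y_s\le 1}|\Delta(B_{\mathbf{y}},(\beta_n)_{n=1}^N)/N|$. Cantor expansion and odometer: for a sequence of integers $Q=(q_1,q_2,\dots)$ with $q_j\ge2$, put $Q_j=q_1\cdots q_j$. Every $x\in[0,1)$ has a unique expansion $x=\sum_{j\ge1}x_j/Q_j$ with $x_j\in\{0,\dots,q_j-1\}$ and $x_j\neq q_j-1$ for infinitely many $j$. The odometer transform is $T_Q(x)=(x_k+1)/Q_k+\sum_{j\ge k+1}x_j/Q_j$, where $k=\min\{j: x_j\neq q_j-1\}$; $T_Q^0(x)=x$ and $T_Q^n=T_Q\circ T_Q^{n-1}$. Generalized Halton sequence: with $\tilde P_{i,j}=\prod_{k=1}^j p_{i,k}$, let $T_{\boldsymbol{\mathcal{P}}}(\mathbf{x})=(T_{\mathcal{P}_1}(x_1),\dots,T_{\mathcal{P}_s}(x_s))$ for $\mathbf{x}=(x_1,\dots,x_s)\in[0,1)^s$ (each $T_{\mathcal{P}_i}$ being the odometer for the sequence $\mathcal{P}_i$). For $x_i=\sum_{j\ge1}x_{i,j}/\tilde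 P_{i,j}$ (Cantor expansion with respect to $\mathcal{P}_i$) define $\tilde\Sigma_i(x_i)=\sum_{j\ge1}\sigma_{i,j}(x_{i,j})/\tilde P_{i,j}$ and $\tilde{\mathbf{S}}(\mathbf{x})=(\tilde\Sigma_1(x_1),\dots,\tilde\Sigma_s(x_s))$. Then $H_{\boldsymbol{\mathcal{P}}}^{\mathbf{S}}(n,\mathbf{x})=\tilde{\mathbf{S}}(T_{\boldsymbol{\mathcal{P}}}^n(\mathbf{x}))$ for $n=0,1,2,\dots$. *)

theory Defs
  imports "HOL-Analysis.Analysis"
begin

text \<open>Sequences are indexed from 1; the value at index 0 of a base sequence is never used.\<close>

definition cantor_prod :: "(nat \<Rightarrow> nat) \<Rightarrow> nat \<Rightarrow> nat" where
  "cantor_prod q j = (\<Prod>k = 1..j. q k)"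

text \<open>The condition \<open>d 0 = 0\<close> only fixes the unused entry, so that the digit sequence
  is unique as a function on the naturals.\<close>

definition is_cantor_expansion :: "(nat \<Rightarrow> nat) \<Rightarrow> real \<Rightarrow> (nat \<Rightarrow> nat) \<Rightarrow> bool" where
  "is_cantor_expansion q x d \<longleftrightarrow>
     d 0 = 0 \<and> (\<forall>j\<ge>1. d j \<in> {0..q j - 1}) \<and> infinite {j. j \<ge> 1 \<and> d j \<noteq> q j - 1} \<and>
     (\<lambda>j. real (d (Suc j)) / real (cantor_prod q (Suc j))) sums x"

text \<open>Meaningful for \<open>x\<close> in \<open>[0,1)\<close> and bases \<open>q j \<ge> 2\<close>, where the expansion exists and is unique.\<close>

definition cantor_digits :: "(nat \<Rightarrow> nat) \<Rightarrow> real \<Rightarrow> nat \<Rightarrow> nat" where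
  "cantor_digits q x = (THE d. is_cantor_expansion q x d)"

definition odometer :: "(nat \<Rightarrow> nat) \<Rightarrow> real \<Rightarrow> real" where
  "odometer q x =
     (let d = cantor_digits q x;
          k = (LEAST j. j \<ge> 1 \<and> d j \<noteq> q j - 1)
      in (real (d k) + 1) / real (cantor_prod q k) +
         (\<Sum>j. real (d (j + (k + 1))) / real (cantor_prod q (j + (k + 1)))))"

definition odometer_vec :: "('d \<Rightarrow> nat \<Rightarrow> nat) \<Rightarrow> real ^ 'd \<Rightarrow> real ^ 'd::finite" where
  "odometer_vec p x = (\<chi> i. odometer (p i) (x $ i))"

definition digit_scramble :: "(nat \<Rightarrow> nat) \<Rightarrow> (nat \<Rightarrow> nat \<Rightarrow> nat) \<Rightarrow> real \<Rightarrow> real" where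
  "digit_scramble q \<sigma> x =
     (\<Sum>j. real (\<sigma> (Suc j) (cantor_digits q x (Suc j))) / real (cantor_prod q (Suc j)))"

definition digit_scramble_vec ::
  "('d \<Rightarrow> nat \<Rightarrow> nat) \<Rightarrow> ('d \<Rightarrow> nat \<Rightarrow> nat \<Rightarrow> nat) \<Rightarrow> real ^ 'd \<Rightarrow> real ^ 'd::finite" where
  "digit_scramble_vec p \<sigma> x = (\<chi> i. digit_scramble (p i) (\<sigma> i) (x $ i))"

definition halton ::
  "('d \<Rightarrow> nat \<Rightarrow> nat) \<Rightarrow> ('d \<Rightarrow> nat \<Rightarrow> nat \<Rightarrow> nat) \<Rightarrow> nat \<Rightarrow> real ^ 'd \<Rightarrow> real ^ 'd::finite" where
  "halton p \<sigma> n x = digit_scramble_vec p \<sigma> ((odometer_vec p ^^ n) x)"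

definition anchored_box :: "real ^ 'd \<Rightarrow> (real ^ 'd::finite) set" where
  "anchored_box y = {z. \<forall>i. z $ i \<in> {0..<y $ i}}"

definition local_discrepancy :: "real ^ 'd \<Rightarrow> (nat \<Rightarrow> real ^ 'd::finite) \<Rightarrow> nat \<Rightarrow> real" where
  "local_discrepancy y \<beta> N = (\<Sum>n = 1..N. indicator (anchored_box y) (\<beta> n) - (\<Prod>i\<in>UNIV. y $ i))"

definition star_discrepancy :: "(nat \<Rightarrow> real ^ 'd::finite) \<Rightarrow> nat \<Rightarrow> real" where
  "star_discrepancy \<beta> N =
     (SUP y\<in>{y. \<forall>i. y $ i \<in> {0<..1}}. \<bar>local_discrepancy y \<beta> N / real N\<bar>)"

definition unit_cube :: "(real ^ 'd::finite) set" where
  "unit_cube = {x. \<forall>i. x $ i \<in> {0..<1}}"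

end

theory Submission
  imports Defs "HOL-Number_Theory.Cong"
begin

text \<open>
  Fix finite sets \<open>S\<^sub>i\<close> of digit positions and let \<open>y\<^sub>i = \<Sum>j\<in>S\<^sub>i. 1 / P\<^sub>i\<^sub>,\<^sub>j\<close>. The box below \<open>y\<close> is the
  disjoint union over \<open>k \<in> \<Prod>S\<^sub>i\<close> of elementary boxes, and each of them is hit exactly when the
  time \<open>n\<close> lies in a residue class modulo \<open>P\<^sub>k = \<Prod>P\<^sub>i\<^sub>,\<^sub>k\<^sub>i\<close>. By the Chinese remainder theorem there is a
  time \<open>M\<^sub>0\<close> at which the orbit agrees with the digits of \<open>y\<close> in every coordinate; counting time
  from \<open>M\<^sub>0\<close>, all lower digits cancel and the residue of box \<open>k\<close> is \<open>r\<^sub>k P\<^sub>k / Q\<close>, where \<open>Q\<close> is the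
  product of the bases at the positions \<open>k\<^sub>i\<close>. Averaging the discrepancy over a full period,
  box \<open>k\<close> contributes \<open>1/2 - r\<^sub>k/Q + 1/(2P\<^sub>k)\<close>.

  By the pigeonhole principle the positions can be restricted so that the bases and the residues
  of the products \<open>P\<^sub>i\<^sub>,\<^sub>j\<close> modulo the other bases are constant. Then \<open>r\<^sub>k\<close> modulo the base of the
  coordinate \<open>i\<close> depends only on the difference \<open>\<sigma>\<^sup>-\<^sup>1(0) - \<sigma>\<^sup>-\<^sup>1(1)\<close> at the position \<open>k\<^sub>i\<close>; it does not
  vanish, so that \<open>r\<^sub>k/Q \<noteq> 1/2\<close> as soon as there are two coordinates. A suitable choice of \<open>S\<^sub>i\<close>
  makes all contributions have the same sign, and their number is of order \<open>log\<^sup>s N\<close>.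
\<close>

section \<open>Cantor expansions\<close>

lemma cantor_prod_0 [simp]: "cantor_prod q 0 = 1"
  by (simp add: cantor_prod_def)

lemma cantor_prod_Suc: "cantor_prod q (Suc j) = cantor_prod q j * q (Suc j)"
  by (simp add: cantor_prod_def)

lemma cantor_prod_dvd: "i \<le> j \<Longrightarrow> cantor_prod q i dvd cantor_prod q j"
  by (induction rule: dec_induct) (auto simp: cantor_prod_Suc)

lemma cantor_prod_eq_mult: "j \<ge> 1 \<Longrightarrow> cantor_prod q j = cantor_prod q (j - 1) * q j"
  using cantor_prod_Suc[of q "j - 1"] by simp

definition lex_less :: "(nat \<Rightarrow> nat) \<Rightarrow> (nat \<Rightarrow> nat) \<Rightarrow> bool" where
  "lex_less e f \<longleftrightarrow> (\<exists>j\<ge>1. (\<forall>l\<in>{1..<j}. e l = f l) \<and> e j < f j)"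

lemma lex_less_linear: "lex_less e f \<or> lex_less f e \<or> (\<forall>j\<ge>1. e j = f j)"
proof (rule ccontr)
  assume contra: "\<not> ?thesis"
  define k where "k = (LEAST k. k \<ge> 1 \<and> e k \<noteq> f k)"
  have first_difference: "k \<ge> 1 \<and> e k \<noteq> f k"
    unfolding k_def using contra LeastI_ex[of "\<lambda>k. k \<ge> 1 \<and> e k \<noteq> f k"] by blast
  have agree: "e l = f l" if "l \<in> {1..<k}" for l
    using not_less_Least[of l "\<lambda>k. k \<ge> 1 \<and> e k \<noteq> f k"] that unfolding k_def by auto
  from first_difference consider (less) "e k < f k" | (greater) "f k < e k" by linarith
  then show False
  proof cases
    case less
    then have "lex_less e f" using first_difference agree unfolding lex_less_def by blast
    with contra show False by blast
  next
    case greater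
    then have "lex_less f e" using first_difference agree unfolding lex_less_def by auto
    with contra show False by blast
  qed
qed

locale cantor_base =
  fixes q :: "nat \<Rightarrow> nat"
  assumes base_ge_2: "j \<ge> 1 \<Longrightarrow> q j \<ge> 2"
begin

abbreviation P :: "nat \<Rightarrow> nat" where
  "P \<equiv> cantor_prod q"

definition digit_seq :: "(nat \<Rightarrow> nat) \<Rightarrow> bool" where
  "digit_seq e \<longleftrightarrow> (\<forall>j\<ge>1. e j < q j)"

definition eventually_max :: "(nat \<Rightarrow> nat) \<Rightarrow> bool" where
  "eventually_max e \<longleftrightarrow> (\<forall>\<^sub>F j in sequentially. e j = q j - 1)"

definition tail :: "(nat \<Rightarrow> nat) \<Rightarrow> nat \<Rightarrow> real" where
  "tail e j = (\<Sum>l. real (e (l + Suc j)) / real (P (l + Suc j)))"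

lemma digit_less: "digit_seq e \<Longrightarrow> j \<ge> 1 \<Longrightarrow> e j < q j"
  by (simp add: digit_seq_def)

lemma eventually_max_cong:
  assumes "\<forall>\<^sub>F j in sequentially. e j = f j"
  shows "eventually_max e \<longleftrightarrow> eventually_max f"
  unfolding eventually_max_def by (intro eventually_subst) (use assms in eventually_elim, simp)

lemma power_2_le_P: "2 ^ j \<le> P j"
proof (induction j)
  case (Suc j)
  then show ?case
    using base_ge_2[of "Suc j"] mult_le_mono[OF Suc, of 2 "q (Suc j)"]
    by (simp add: cantor_prod_Suc mult.commute)
qed simp

lemma P_pos [simp]: "P j > 0"
  using power_2_le_P[of j] by (metis less_le_trans pos2 zero_less_power)

lemma P_neq_0 [simp]: "P j \<noteq> 0"
  using P_pos[of j] by linarith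

lemma inverse_P_tendsto_0: "(\<lambda>j. 1 / real (P j)) \<longlonglongrightarrow> 0"
proof (rule tendsto_sandwich[where f = "\<lambda>_. 0" and h = "\<lambda>j. (1/2) ^ j"])
  have "(2::real) ^ j \<le> real (P j)" for j
    using power_2_le_P[of j] by (metis of_nat_le_iff of_nat_numeral of_nat_power)
  then show "\<forall>\<^sub>F j in sequentially. 1 / real (P j) \<le> (1/2) ^ j"
    by (simp add: power_one_over frac_le)
  show "(\<lambda>j. (1/2::real) ^ j) \<longlonglongrightarrow> 0"
    by (intro LIMSEQ_power_zero) auto
qed auto

lemma inverse_P_telescope:
  "(\<lambda>l. 1 / real (P (l + j)) - 1 / real (P (l + Suc j))) sums (1 / real (P j))"
  using telescope_sums'[OF LIMSEQ_ignore_initial_segment[OF inverse_P_tendsto_0, of j]] by simp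

lemma inverse_P_diff:
  "1 / real (P j) - 1 / real (P (Suc j)) = (real (q (Suc j)) - 1) / real (P (Suc j))"
  using base_ge_2[of "Suc j"] by (simp add: cantor_prod_Suc field_simps)

lemma digit_le: "digit_seq e \<Longrightarrow> j \<ge> 1 \<Longrightarrow> real (e j) \<le> real (q j) - 1"
  using digit_less[of e j] by linarith

lemma summable_tail:
  assumes "digit_seq e"
  shows "summable (\<lambda>l. real (e (l + Suc j)) / real (P (l + Suc j)))"
proof (rule summable_comparison_test'[OF sums_summable[OF inverse_P_telescope[of j]]])
  fix l
  have "real (e (l + Suc j)) / real (P (l + Suc j)) \<le> (real (q (l + Suc j)) - 1) / real (P (l + Suc j))"
    using digit_le[OF assms] by (intro divide_right_mono) auto
  then show "norm (real (e (l + Suc j)) / real (P (l + Suc j))) \<le>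
      1 / real (P (l + j)) - 1 / real (P (l + Suc j))"
    using inverse_P_diff[of "l + j"] by simp
qed

lemma tail_complement_sums:
  assumes "digit_seq e"
  shows "(\<lambda>l. (real (q (l + Suc j)) - 1 - real (e (l + Suc j))) / real (P (l + Suc j)))
    sums (1 / real (P j) - tail e j)"
proof -
  have "(real (q (l + Suc j)) - 1 - real (e (l + Suc j))) / real (P (l + Suc j)) =
      1 / real (P (l + j)) - 1 / real (P (l + Suc j)) - real (e (l + Suc j)) / real (P (l + Suc j))"
    for l
    using inverse_P_diff[of "l + j"] by (simp add: diff_divide_distrib)
  then show ?thesis
    using sums_diff[OF inverse_P_telescope summable_sums[OF summable_tail[OF assms]], of j j]
    by (simp add: tail_def)
qed

lemma tail_nonneg: "digit_seq e \<Longrightarrow> 0 \<le> tail e j"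
  unfolding tail_def by (intro suminf_nonneg summable_tail) auto

lemma tail_le: "digit_seq e \<Longrightarrow> tail e j \<le> 1 / real (P j)"
  using sums_le[OF _ sums_zero tail_complement_sums[of e j]] digit_le[of e] by force

lemma tail_eq_max_iff:
  assumes "digit_seq e"
  shows "tail e j = 1 / real (P j) \<longleftrightarrow> (\<forall>l>j. e l = q l - 1)"
proof -
  let ?g = "\<lambda>l. (real (q (l + Suc j)) - 1 - real (e (l + Suc j))) / real (P (l + Suc j))"
  have "tail e j = 1 / real (P j) \<longleftrightarrow> suminf ?g = 0"
    using sums_unique[OF tail_complement_sums[OF assms, of j]] by auto
  also have "\<dots> \<longleftrightarrow> (\<forall>l. ?g l = 0)"
    using digit_le[OF assms]
    by (intro suminf_eq_zero_iff sums_summable[OF tail_complement_sums[OF assms]]) auto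
  also have "\<dots> \<longleftrightarrow> (\<forall>l. e (l + Suc j) = q (l + Suc j) - 1)"
  proof -
    have "?g l = 0 \<longleftrightarrow> e (l + Suc j) = q (l + Suc j) - 1" for l
      using base_ge_2[of "l + Suc j"] by (auto simp: eq_diff_eq algebra_simps of_nat_diff)
    then show ?thesis by blast
  qed
  also have "\<dots> \<longleftrightarrow> (\<forall>l>j. e l = q l - 1)"
    by (metis Suc_leI le_add2 le_add_diff_inverse2 less_eq_Suc_le)
  finally show ?thesis .
qed

lemma tail_less:
  assumes "digit_seq e" "\<not> eventually_max e"
  shows "tail e j < 1 / real (P j)"
proof -
  have "\<not> (\<forall>l>j. e l = q l - 1)"
    using assms(2) unfolding eventually_max_def eventually_at_top_dense by blast
  then show ?thesis
    using tail_le[OF assms(1), of j] tail_eq_max_iff[OF assms(1), of j] by (simp add: order_less_le)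
qed

lemma tail_0_split:
  assumes "digit_seq e"
  shows "tail e 0 = (\<Sum>l=1..j. real (e l) / real (P l)) + tail e j"
proof (induction j)
  case (Suc j)
  have "tail e j = real (e (Suc j)) / real (P (Suc j)) + tail e (Suc j)"
    using suminf_split_head[OF summable_tail[OF assms, of j]] by (simp add: tail_def)
  then show ?case using Suc by simp
qed simp

lemma lex_less_tail_obtains:
  assumes "digit_seq e" "digit_seq f" "lex_less e f"
  obtains j where "tail e 0 - tail e j + 1 / real (P j) \<le> tail f 0 - tail f j"
proof -
  obtain j where first_difference: "j \<ge> 1" "\<And>l. l \<in> {1..<j} \<Longrightarrow> e l = f l" "e j < f j"
    using assms(3) unfolding lex_less_def by blast
  then obtain i where j_eq: "j = Suc i" by (cases j) auto
  have "(\<Sum>l=1..i. real (e l) / real (P l)) = (\<Sum>l=1..i. real (f l) / real (P l))"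
    using first_difference(2) j_eq by (intro sum.cong) auto
  moreover have "real (e j) / real (P j) + 1 / real (P j) \<le> real (f j) / real (P j)"
    unfolding add_divide_distrib[symmetric] using first_difference(3) by (intro divide_right_mono) auto
  ultimately show ?thesis
    using that[of j] tail_0_split[OF assms(1), of j] tail_0_split[OF assms(2), of j] j_eq by simp
qed

lemma tail_mono_lex:
  assumes "digit_seq e" "digit_seq f" "lex_less e f"
  shows "tail e 0 \<le> tail f 0"
proof -
  obtain j where "tail e 0 - tail e j + 1 / real (P j) \<le> tail f 0 - tail f j"
    using assms by (rule lex_less_tail_obtains)
  then show ?thesis using tail_le[OF assms(1), of j] tail_nonneg[OF assms(2), of j] by linarith
qed

lemma tail_strict_mono_lex:
  assumes "digit_seq e" "digit_seq f" "lex_less e f" "\<not> eventually_max e"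
  shows "tail e 0 < tail f 0"
proof -
  obtain j where "tail e 0 - tail e j + 1 / real (P j) \<le> tail f 0 - tail f j"
    using assms(1-3) by (rule lex_less_tail_obtains)
  then show ?thesis using tail_less[OF assms(1,4), of j] tail_nonneg[OF assms(2), of j] by linarith
qed

lemma tail_0_cong: "(\<And>j. j \<ge> 1 \<Longrightarrow> e j = f j) \<Longrightarrow> tail e 0 = tail f 0"
  by (simp add: tail_def)

lemma lex_less_iff_tail_less:
  assumes "digit_seq e" "digit_seq f" "\<not> eventually_max e" "\<not> eventually_max f"
  shows "lex_less e f \<longleftrightarrow> tail e 0 < tail f 0"
  using lex_less_linear[of e f] tail_0_cong[of e f] tail_strict_mono_lex[OF assms(1,2) _ assms(3)]
    tail_strict_mono_lex[OF assms(2,1) _ assms(4)]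
  by (metis less_irrefl less_asym)

text \<open>An expansion ending in maximal digits has the same value as a lexicographically greater one,
  so the order of the values is here the weak one.\<close>

lemma lex_less_iff_tail_le:
  assumes "digit_seq e" "digit_seq f" "eventually_max e" "\<not> eventually_max f"
  shows "lex_less e f \<longleftrightarrow> tail e 0 \<le> tail f 0"
proof -
  have "\<not> (\<forall>j\<ge>1. e j = f j)"
    using eventually_max_cong[of e f] assms(3,4) unfolding eventually_sequentially by blast
  then show ?thesis
    using lex_less_linear[of e f] tail_mono_lex[OF assms(1,2)]
      tail_strict_mono_lex[OF assms(2,1) _ assms(4)] by (metis leD)
qed

lemma expansion_iff:
  "is_cantor_expansion q x d \<longleftrightarrow> d 0 = 0 \<and> digit_seq d \<and> \<not> eventually_max d \<and> x = tail d 0"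
proof -
  have "eventually_max d \<longleftrightarrow> (\<forall>\<^sub>F j in cofinite. j \<ge> 1 \<longrightarrow> d j = q j - 1)"
    unfolding eventually_max_def cofinite_eq_sequentially
    by (intro eventually_subst eventually_mono[OF eventually_ge_at_top[of 1]]) auto
  then have "infinite {j. j \<ge> 1 \<and> d j \<noteq> q j - 1} \<longleftrightarrow> \<not> eventually_max d"
    by (simp add: eventually_cofinite)
  moreover have "(\<forall>j\<ge>1. d j \<in> {0..q j - 1}) \<longleftrightarrow> digit_seq d"
  proof -
    have "d j \<in> {0..q j - 1} \<longleftrightarrow> d j < q j" if "j \<ge> 1" for j
      using base_ge_2[OF that] by auto
    then show ?thesis unfolding digit_seq_def by blast
  qed
  moreover have "(\<lambda>j. real (d (Suc j)) / real (P (Suc j))) sums x \<longleftrightarrow> x = tail d 0" if "digit_seq d"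
    using summable_tail[OF that, of 0] by (auto simp: tail_def sums_iff)
  ultimately show ?thesis unfolding is_cantor_expansion_def by blast
qed

lemma expansion_unique:
  assumes "is_cantor_expansion q x d" "is_cantor_expansion q x f"
  shows "d = f"
proof -
  have "\<forall>j\<ge>1. d j = f j"
    using assms lex_less_linear[of d f] lex_less_iff_tail_less[of d f] lex_less_iff_tail_less[of f d]
    unfolding expansion_iff by auto
  then show ?thesis
    using assms unfolding expansion_iff by (metis ext less_one linorder_not_less)
qed

definition floor_digits :: "real \<Rightarrow> nat \<Rightarrow> nat" where
  "floor_digits x j = (if j = 0 then 0 else nat \<lfloor>x * real (P j)\<rfloor> mod q j)"

lemma digit_seq_floor_digits: "digit_seq (floor_digits x)"
  unfolding digit_seq_def floor_digits_def
proof (intro allI impI)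
  fix j :: nat
  assume "j \<ge> 1"
  then show "(if j = 0 then 0 else nat \<lfloor>x * real (P j)\<rfloor> mod q j) < q j"
    using base_ge_2[of j] by simp
qed

lemma nat_floor_mult_P_div:
  assumes "x \<ge> 0"
  shows "nat \<lfloor>x * real (P (Suc j))\<rfloor> div q (Suc j) = nat \<lfloor>x * real (P j)\<rfloor>"
proof -
  define b where "b = q (Suc j)"
  have "b > 0" using base_ge_2[of "Suc j"] by (simp add: b_def)
  have "nat \<lfloor>x * real (P j) * real b\<rfloor> div b = nat (\<lfloor>x * real (P j) * real b\<rfloor> div int b)"
    using assms by (simp add: nat_div_distrib)
  also have "\<lfloor>x * real (P j) * real b\<rfloor> div int b = \<lfloor>x * real (P j) * real b / real_of_int (int b)\<rfloor>"
    by (subst floor_divide_real_eq_div) auto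
  finally show ?thesis using \<open>b > 0\<close> by (simp add: cantor_prod_Suc b_def mult.assoc)
qed

lemma sum_floor_digits:
  assumes "x \<in> {0..<1}"
  shows "(\<Sum>l=1..j. real (floor_digits x l) / real (P l)) = real (nat \<lfloor>x * real (P j)\<rfloor>) / real (P j)"
proof (induction j)
  case 0
  show ?case using assms by simp
next
  case (Suc j)
  have "nat \<lfloor>x * real (P (Suc j))\<rfloor> = nat \<lfloor>x * real (P j)\<rfloor> * q (Suc j) + floor_digits x (Suc j)"
    using nat_floor_mult_P_div[of x j] assms by (simp add: floor_digits_def) (metis div_mult_mod_eq)
  then show ?case
    using Suc base_ge_2[of "Suc j"] by (simp add: cantor_prod_Suc add_divide_distrib)
qed

lemma expansion_floor_digits:
  assumes x_in_unit: "x \<in> {0..<1}"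
  shows "is_cantor_expansion q x (floor_digits x)"
proof -
  let ?s = "\<lambda>j. \<Sum>l=1..j. real (floor_digits x l) / real (P l)"
  note split = tail_0_split[OF digit_seq_floor_digits, of x]
  have "real (nat \<lfloor>x * real (P j)\<rfloor>) \<le> x * real (P j)"
    "x * real (P j) < real (nat \<lfloor>x * real (P j)\<rfloor>) + 1" for j
    using x_in_unit by (auto simp: of_nat_nat)
  then have approx: "?s j \<le> x" "x < ?s j + 1 / real (P j)" for j
    unfolding sum_floor_digits[OF x_in_unit] add_divide_distrib[symmetric]
    by (simp_all add: pos_divide_le_eq pos_less_divide_eq)
  have "\<bar>x - tail (floor_digits x) 0\<bar> \<le> 1 / real (P j)" for j
    using approx[of j] split[of j] tail_nonneg[OF digit_seq_floor_digits, of x j]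
      tail_le[OF digit_seq_floor_digits, of x j] by linarith
  then have "\<bar>x - tail (floor_digits x) 0\<bar> \<le> 0"
    by (intro LIMSEQ_le_const[OF inverse_P_tendsto_0]) auto
  then have x_eq: "x = tail (floor_digits x) 0" by simp
  have "\<not> eventually_max (floor_digits x)"
  proof
    assume "eventually_max (floor_digits x)"
    then obtain j where "\<forall>l>j. floor_digits x l = q l - 1"
      unfolding eventually_max_def eventually_at_top_dense by blast
    then have "tail (floor_digits x) j = 1 / real (P j)"
      by (simp add: tail_eq_max_iff digit_seq_floor_digits)
    then show False using approx(2)[of j] split[of j] x_eq by linarith
  qed
  then show ?thesis
    using x_eq digit_seq_floor_digits unfolding expansion_iff by (simp add: floor_digits_def)
qed

lemma cantor_digits_eq: "is_cantor_expansion q x d \<Longrightarrow> cantor_digits q x = d"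
  unfolding cantor_digits_def by (rule the_equality) (auto dest: expansion_unique)

lemma expansion_cantor_digits: "x \<in> {0..<1} \<Longrightarrow> is_cantor_expansion q x (cantor_digits q x)"
  using expansion_floor_digits[of x] by (simp add: cantor_digits_eq)

lemma digit_seq_cantor_digits: "x \<in> {0..<1} \<Longrightarrow> digit_seq (cantor_digits q x)"
  using expansion_cantor_digits unfolding expansion_iff by blast

lemma expansion_in_unit: "is_cantor_expansion q x d \<Longrightarrow> x \<in> {0..<1}"
  using tail_less[of d 0] tail_nonneg[of d 0] unfolding expansion_iff by simp

subsection \<open>The odometer\<close>

definition prefix_num :: "(nat \<Rightarrow> nat) \<Rightarrow> nat \<Rightarrow> nat" where
  "prefix_num d n = (\<Sum>j=1..n. d j * P (j - 1))"

lemma prefix_num_0 [simp]: "prefix_num d 0 = 0"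
  and prefix_num_Suc: "prefix_num d (Suc n) = prefix_num d n + d (Suc n) * P n"
  by (auto simp: prefix_num_def)

lemma prefix_num_less: "digit_seq d \<Longrightarrow> prefix_num d n < P n"
proof (induction n)
  case (Suc n)
  have "(d (Suc n) + 1) * P n \<le> q (Suc n) * P n"
    using digit_less[OF Suc.prems, of "Suc n"] by (intro mult_le_mono1) simp
  then show ?case using Suc by (simp add: prefix_num_Suc cantor_prod_Suc algebra_simps)
qed simp

lemma prefix_num_eq_iff:
  assumes "digit_seq d" "digit_seq f"
  shows "prefix_num d n = prefix_num f n \<longleftrightarrow> (\<forall>j\<in>{1..n}. d j = f j)"
proof (induction n)
  case (Suc n)
  have div_mod: "prefix_num e (Suc n) div P n = e (Suc n)"
    "prefix_num e (Suc n) mod P n = prefix_num e n"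
    if "digit_seq e" for e
    using prefix_num_less[OF that, of n] by (simp_all add: prefix_num_Suc)
  have "prefix_num d (Suc n) = prefix_num f (Suc n) \<longleftrightarrow>
      prefix_num d n = prefix_num f n \<and> d (Suc n) = f (Suc n)"
    using div_mod[OF assms(1)] div_mod[OF assms(2)] by (metis prefix_num_Suc)
  then show ?case using Suc by (auto simp: le_Suc_eq)
qed simp

lemma prefix_num_cong_iff:
  assumes "digit_seq d" "digit_seq f"
  shows "[prefix_num d n = prefix_num f n] (mod P n) \<longleftrightarrow> (\<forall>j\<in>{1..n}. d j = f j)"
  using prefix_num_eq_iff[OF assms] prefix_num_less[OF assms(1)] prefix_num_less[OF assms(2)]
  by (simp add: cong_def)

lemma prefix_num_cong_le: "j \<le> n \<Longrightarrow> [prefix_num d n = prefix_num d j] (mod P j)"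
proof (induction rule: dec_induct)
  case (step n)
  have "[prefix_num d n + d (Suc n) * P n = prefix_num d j + 0] (mod P j)"
    using step cantor_prod_dvd[of j n q] by (intro cong_add) (auto simp: cong_0_iff)
  then show ?case by (simp add: prefix_num_Suc)
qed simp

definition carry_index :: "(nat \<Rightarrow> nat) \<Rightarrow> nat" where
  "carry_index d = (LEAST j. j \<ge> 1 \<and> d j \<noteq> q j - 1)"

definition digit_succ :: "(nat \<Rightarrow> nat) \<Rightarrow> nat \<Rightarrow> nat" where
  "digit_succ d j =
     (if j < carry_index d then 0 else if j = carry_index d then d j + 1 else d j)"

lemma
  assumes "\<not> eventually_max d"
  shows carry_index_ge_1: "carry_index d \<ge> 1"
    and digit_carry_index: "d (carry_index d) \<noteq> q (carry_index d) - 1"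
    and digit_below_carry_index: "j \<ge> 1 \<Longrightarrow> j < carry_index d \<Longrightarrow> d j = q j - 1"
proof -
  have "\<exists>j\<ge>1. d j \<noteq> q j - 1"
    using assms unfolding eventually_max_def eventually_sequentially by blast
  then show "carry_index d \<ge> 1" "d (carry_index d) \<noteq> q (carry_index d) - 1"
    using LeastI_ex[of "\<lambda>j. j \<ge> 1 \<and> d j \<noteq> q j - 1"] unfolding carry_index_def by auto
  show "j \<ge> 1 \<Longrightarrow> j < carry_index d \<Longrightarrow> d j = q j - 1"
    unfolding carry_index_def using not_less_Least by blast
qed

lemma digit_seq_digit_succ:
  assumes "digit_seq d" "\<not> eventually_max d"
  shows "digit_seq (digit_succ d)"
proof -
  have "d (carry_index d) + 1 < q (carry_index d)"
    using carry_index_ge_1[OF assms(2)] digit_carry_index[OF assms(2)] digit_less[OF assms(1)]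
    by (metis Suc_eq_plus1 Suc_lessI diff_Suc_1)
  then show ?thesis
    using digit_less[OF assms(1)] base_ge_2 by (force simp: digit_seq_def digit_succ_def)
qed

lemma digit_succ_eventually_eq: "\<forall>\<^sub>F j in sequentially. digit_succ d j = d j"
  using eventually_gt_at_top[of "carry_index d"] by eventually_elim (simp add: digit_succ_def)

lemma prefix_num_digit_succ:
  assumes "\<not> eventually_max d"
  shows "prefix_num (digit_succ d) n + (if n < carry_index d then P n else 0) = prefix_num d n + 1"
proof (induction n)
  case 0
  show ?case using carry_index_ge_1[OF assms] by simp
next
  case (Suc n)
  consider (below) "Suc n < carry_index d" | (here) "Suc n = carry_index d"
    | (above) "carry_index d < Suc n"
    by linarith
  then show ?case
  proof cases
    case below
    then have "P (Suc n) = P n + d (Suc n) * P n"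
      using digit_below_carry_index[OF assms, of "Suc n"] base_ge_2[of "Suc n"]
      by (simp add: cantor_prod_Suc algebra_simps diff_mult_distrib)
    then show ?thesis using below Suc by (simp add: prefix_num_Suc digit_succ_def)
  next
    case here
    have "digit_succ d (Suc n) = d (Suc n) + 1" by (simp add: digit_succ_def here)
    then show ?thesis using Suc by (simp add: prefix_num_Suc here[symmetric])
  next
    case above
    then have "digit_succ d (Suc n) = d (Suc n)" by (simp add: digit_succ_def)
    then show ?thesis using above Suc by (simp add: prefix_num_Suc)
  qed
qed

lemma prefix_num_digit_succ_cong:
  assumes "\<not> eventually_max d"
  shows "[prefix_num (digit_succ d) n = prefix_num d n + 1] (mod P n)"
  using prefix_num_digit_succ[OF assms, of n, symmetric] by (simp add: cong_def)

lemma expansion_odometer: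
  assumes "is_cantor_expansion q x d"
  shows "is_cantor_expansion q (odometer q x) (digit_succ d)"
proof -
  have digits: "digit_seq d" "\<not> eventually_max d" using assms by (auto simp: expansion_iff)
  define k where "k = carry_index d"
  have k_ge_1: "k \<ge> 1" using carry_index_ge_1[OF digits(2)] by (simp add: k_def)
  have "tail (digit_succ d) 0 = (\<Sum>l=1..k. real (digit_succ d l) / real (P l)) + tail (digit_succ d) k"
    by (rule tail_0_split[OF digit_seq_digit_succ[OF digits]])
  also have "(\<Sum>l=1..k. real (digit_succ d l) / real (P l)) =
      (\<Sum>l=1..k. if l = k then (real (d k) + 1) / real (P k) else 0)"
    by (intro sum.cong) (auto simp: digit_succ_def k_def)
  also have "\<dots> = (real (d k) + 1) / real (P k)"
    using k_ge_1 by simp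
  also have "tail (digit_succ d) k = (\<Sum>j. real (d (j + (k + 1))) / real (P (j + (k + 1))))"
    by (simp add: tail_def digit_succ_def k_def)
  finally have "odometer q x = tail (digit_succ d) 0"
    unfolding odometer_def cantor_digits_eq[OF assms] Let_def k_def carry_index_def by simp
  moreover have "digit_succ d 0 = 0" using k_ge_1 by (simp add: digit_succ_def k_def)
  moreover have "\<not> eventually_max (digit_succ d)"
    using eventually_max_cong[OF digit_succ_eventually_eq] digits(2) by blast
  ultimately show ?thesis
    using digit_seq_digit_succ[OF digits] by (simp add: expansion_iff)
qed

lemma cantor_digits_odometer:
  "x \<in> {0..<1} \<Longrightarrow> cantor_digits q (odometer q x) = digit_succ (cantor_digits q x)"
  by (intro cantor_digits_eq expansion_odometer expansion_cantor_digits)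

lemma odometer_in_unit: "x \<in> {0..<1} \<Longrightarrow> odometer q x \<in> {0..<1}"
  by (rule expansion_in_unit[OF expansion_odometer[OF expansion_cantor_digits]])

lemma odometer_funpow_in_unit: "x \<in> {0..<1} \<Longrightarrow> (odometer q ^^ n) x \<in> {0..<1}"
  by (induction n) (simp_all add: odometer_in_unit del: atLeastLessThan_iff)

lemma cantor_digits_odometer_funpow:
  assumes "x \<in> {0..<1}"
  shows "cantor_digits q ((odometer q ^^ Suc n) x) = digit_succ (cantor_digits q ((odometer q ^^ n) x))"
  using cantor_digits_odometer[OF odometer_funpow_in_unit[OF assms]] by simp

lemma cantor_digits_funpow_eventually_eq:
  assumes "x \<in> {0..<1}"
  shows "\<forall>\<^sub>F j in sequentially. cantor_digits q ((odometer q ^^ n) x) j = cantor_digits q x j"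
proof (induction n)
  case (Suc n)
  show ?case
    unfolding cantor_digits_odometer_funpow[OF assms]
    using Suc digit_succ_eventually_eq[of "cantor_digits q ((odometer q ^^ n) x)"]
    by eventually_elim simp
qed simp

lemma prefix_num_odometer_funpow_cong:
  assumes "x \<in> {0..<1}"
  shows "[prefix_num (cantor_digits q ((odometer q ^^ n) x)) j =
    prefix_num (cantor_digits q x) j + n] (mod P j)"
proof (induction n)
  case (Suc n)
  have "\<not> eventually_max (cantor_digits q ((odometer q ^^ n) x))"
    using expansion_cantor_digits[OF odometer_funpow_in_unit[OF assms]] by (simp add: expansion_iff)
  from cong_trans[OF prefix_num_digit_succ_cong[OF this] cong_add[OF Suc cong_refl[of 1]]]
  show ?case unfolding cantor_digits_odometer_funpow[OF assms] by simp
qed simp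

lemma synchronizing_time_obtains:
  assumes x_in_unit: "x \<in> {0..<1}"
  obtains Z where "\<And>M t j. [M = Z] (mod P n) \<Longrightarrow> j \<le> n \<Longrightarrow>
    [prefix_num (cantor_digits q ((odometer q ^^ (M + t)) x)) j = prefix_num e j + t] (mod P j)"
proof
  let ?d = "cantor_digits q x"
  fix M t j
  assume M_cong: "[M = prefix_num e n + (P n - prefix_num ?d n)] (mod P n)" and j_le: "j \<le> n"
  have "[prefix_num ?d j + M = prefix_num ?d n + M] (mod P j)"
    using prefix_num_cong_le[OF j_le] by (intro cong_add cong_refl) (rule cong_sym)
  also have "[prefix_num ?d n + M = prefix_num e n + P n] (mod P j)"
  proof -
    have "[prefix_num ?d n + M = prefix_num ?d n + (prefix_num e n + (P n - prefix_num ?d n))] (mod P j)"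
      using M_cong j_le by (intro cong_add cong_refl) (rule cong_dvd_modulus_nat[OF _ cantor_prod_dvd])
    then show ?thesis
      using prefix_num_less[OF digit_seq_cantor_digits[OF x_in_unit], of n] by simp
  qed
  also have "[prefix_num e n + P n = prefix_num e j + 0] (mod P j)"
    using prefix_num_cong_le[OF j_le] cantor_prod_dvd[OF j_le]
    by (intro cong_add) (auto simp: cong_0_iff)
  finally have "[prefix_num ?d j + M + t = prefix_num e j + t] (mod P j)"
    by (intro cong_add) simp_all
  then show "[prefix_num (cantor_digits q ((odometer q ^^ (M + t)) x)) j = prefix_num e j + t] (mod P j)"
    using prefix_num_odometer_funpow_cong[OF x_in_unit, of "M + t" j] by (simp add: cong_def add.assoc)
qed

end

section \<open>Scrambled orbits in initial segments\<close>

definition initial_segment :: "bool \<Rightarrow> real \<Rightarrow> real set" where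
  "initial_segment incl b = (if incl then {0..b} else {0..<b})"

definition marks :: "nat set \<Rightarrow> nat \<Rightarrow> nat" where
  "marks S j = of_bool (j \<in> S)"

lemma lex_less_marks_iff:
  assumes "0 \<notin> S"
  shows "lex_less e (marks S) \<longleftrightarrow> (\<exists>j\<in>S. \<forall>l\<in>{1..j}. e l = marks (S - {j}) l)"
proof -
  have "(\<forall>l\<in>{1..<j}. e l = marks S l) \<and> e j < marks S j \<longleftrightarrow>
      j \<in> S \<and> (\<forall>l\<in>{1..j}. e l = marks (S - {j}) l)" if "j \<ge> 1" for j
  proof -
    have "{1..j} = insert j {1..<j}" using that by auto
    then show ?thesis by (auto simp: marks_def)
  qed
  then show ?thesis
    unfolding lex_less_def using assms by (metis less_one linorder_not_less)
qed

lemma sum_of_bool_unique: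
  assumes "finite A" "\<And>a b. a \<in> A \<Longrightarrow> b \<in> A \<Longrightarrow> R a \<Longrightarrow> R b \<Longrightarrow> a = b"
  shows "(\<Sum>a\<in>A. of_bool (R a)) = (of_bool (\<exists>a\<in>A. R a) :: 'a :: semiring_1)"
proof (cases "\<exists>a\<in>A. R a")
  case True
  then obtain a where a_holds: "a \<in> A" "R a" by blast
  then have "(\<Sum>b\<in>A. of_bool (R b)) = (\<Sum>b\<in>A. if b = a then 1 else 0 :: 'a)"
    using assms(2) by (intro sum.cong) auto
  then show ?thesis using a_holds assms(1) by auto
qed auto

lemma of_bool_lex_less_marks:
  assumes "finite S" "0 \<notin> S"
  shows "of_bool (lex_less e (marks S)) =
    (\<Sum>j\<in>S. of_bool (\<forall>l\<in>{1..j}. e l = marks (S - {j}) l) :: 'a :: semiring_1)"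
proof -
  have "i = j" if "i \<in> S" "j \<in> S" "\<forall>l\<in>{1..i}. e l = marks (S - {i}) l"
    "\<forall>l\<in>{1..j}. e l = marks (S - {j}) l" for i j
  proof -
    have "\<not> i < j" if "i \<in> S" "\<forall>l\<in>{1..i}. e l = marks (S - {i}) l"
      "\<forall>l\<in>{1..j}. e l = marks (S - {j}) l" for i j
    proof
      assume "i < j"
      moreover have "i \<ge> 1" using that(1) assms(2) by (metis less_one linorder_not_less)
      ultimately have "marks (S - {i}) i = marks (S - {j}) i" using that(2,3) by force
      then show False using that(1) \<open>i < j\<close> by (simp add: marks_def)
    qed
    then show ?thesis using that by (meson linorder_neqE_nat)
  qed
  then show ?thesis
    unfolding lex_less_marks_iff[OF assms(2)] by (intro sum_of_bool_unique[symmetric] assms)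
qed

context cantor_base
begin

lemma digit_seq_marks: "digit_seq (marks S)"
  unfolding digit_seq_def marks_def using base_ge_2 by fastforce

lemma not_eventually_max_marks:
  assumes "finite S"
  shows "\<not> eventually_max (marks S)"
proof
  assume "eventually_max (marks S)"
  moreover have "\<forall>\<^sub>F j in sequentially. j \<notin> S"
    using assms by (simp add: cofinite_eq_sequentially[symmetric] eventually_cofinite)
  ultimately have "\<forall>\<^sub>F j in sequentially. False"
    unfolding eventually_max_def using eventually_ge_at_top[of 1]
    by eventually_elim (use base_ge_2 in \<open>force simp: marks_def\<close>)
  then show False by simp
qed

lemma tail_marks:
  assumes "S \<subseteq> {1..n}"
  shows "tail (marks S) 0 = (\<Sum>j\<in>S. 1 / real (P j))"
proof -
  have "marks S (l + Suc n) = 0" for l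
    using assms by (auto simp: marks_def)
  then have "tail (marks S) n = 0"
    by (simp add: tail_def)
  moreover have "(\<Sum>l=1..n. real (marks S l) / real (P l)) = (\<Sum>l\<in>S. 1 / real (P l))"
    using assms by (intro sum.mono_neutral_cong_right) (auto simp: marks_def)
  ultimately show ?thesis
    using tail_0_split[OF digit_seq_marks, of S n] by simp
qed

lemma sum_inverse_P_less_1:
  assumes "S \<subseteq> {1..n}"
  shows "(\<Sum>j\<in>S. 1 / real (P j)) < 1"
  using tail_less[OF digit_seq_marks not_eventually_max_marks, of S 0] tail_marks[OF assms]
    finite_subset[OF assms] by simp

end

locale scrambled_base = cantor_base +
  fixes \<sigma> :: "nat \<Rightarrow> nat \<Rightarrow> nat"
  assumes scramble_perm: "j \<ge> 1 \<Longrightarrow> bij_betw (\<sigma> j) {0..q j - 1} {0..q j - 1}"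
begin

definition unscramble :: "nat \<Rightarrow> nat \<Rightarrow> nat" where
  "unscramble j = inv_into {0..q j - 1} (\<sigma> j)"

definition digit_shift :: "nat \<Rightarrow> int" where
  "digit_shift j = int (unscramble j 0) - int (unscramble j 1)"

definition hits :: "nat \<Rightarrow> nat \<Rightarrow> bool" where
  "hits j t \<longleftrightarrow> [int t = digit_shift j * int (P (j - 1))] (mod int (P j))"

lemma unscramble_less: "j \<ge> 1 \<Longrightarrow> c < q j \<Longrightarrow> unscramble j c < q j"
  using bij_betw_apply[OF bij_betw_inv_into[OF scramble_perm], of j c]
  by (simp add: unscramble_def) linarith

lemma scramble_less: "j \<ge> 1 \<Longrightarrow> c < q j \<Longrightarrow> \<sigma> j c < q j"
  using bij_betw_apply[OF scramble_perm, of j c] by simp linarith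

lemma scramble_eq_iff:
  assumes "j \<ge> 1" "c < q j" "a < q j"
  shows "\<sigma> j a = c \<longleftrightarrow> a = unscramble j c"
  using bij_betw_inv_into_left[OF scramble_perm[OF assms(1)], of a]
    bij_betw_inv_into_right[OF scramble_perm[OF assms(1)], of c] assms
  by (auto simp: unscramble_def)

lemma not_dvd_digit_shift:
  assumes "j \<ge> 1"
  shows "\<not> int (q j) dvd digit_shift j"
proof
  assume "int (q j) dvd digit_shift j"
  have base_bounds: "0 < q j" "1 < q j" using base_ge_2[OF assms] by auto
  note less = unscramble_less[OF assms base_bounds(1)] unscramble_less[OF assms base_bounds(2)]
  have "\<bar>digit_shift j\<bar> < int (q j)"
    using less unfolding digit_shift_def by linarith
  with \<open>int (q j) dvd digit_shift j\<close> have "digit_shift j = 0"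
    by (metis abs_of_nat dvd_imp_le_int not_le)
  then have "unscramble j 0 = unscramble j 1" by (simp add: digit_shift_def)
  then show False
    using scramble_eq_iff[OF assms base_bounds(1) less(1)]
      scramble_eq_iff[OF assms base_bounds(2) less(1)] by simp
qed

lemma digit_seq_scramble: "digit_seq d \<Longrightarrow> digit_seq (\<lambda>j. \<sigma> j (d j))"
  using scramble_less by (simp add: digit_seq_def)

lemma digit_seq_unscramble: "digit_seq d \<Longrightarrow> digit_seq (\<lambda>j. unscramble j (d j))"
  using unscramble_less by (simp add: digit_seq_def)

lemma scramble_prefix_eq_iff:
  assumes "digit_seq d" "digit_seq e"
  shows "(\<forall>l\<in>{1..j}. \<sigma> l (d l) = e l) \<longleftrightarrow>
    [prefix_num d j = prefix_num (\<lambda>l. unscramble l (e l)) j] (mod P j)"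
  using scramble_eq_iff digit_less[OF assms(1)] digit_less[OF assms(2)]
  by (simp add: prefix_num_cong_iff[OF assms(1) digit_seq_unscramble[OF assms(2)]])

lemma prefix_num_unscramble_marks:
  assumes "j \<in> S" "j \<ge> 1"
  shows "int (prefix_num (\<lambda>l. unscramble l (marks (S - {j}) l)) j) =
    int (prefix_num (\<lambda>l. unscramble l (marks S l)) j) + digit_shift j * int (P (j - 1))"
proof -
  obtain i where j_eq: "j = Suc i" using assms(2) by (cases j) auto
  have "prefix_num (\<lambda>l. unscramble l (marks (S - {j}) l)) i =
      prefix_num (\<lambda>l. unscramble l (marks S l)) i"
    unfolding prefix_num_def by (intro sum.cong) (auto simp: j_eq marks_def)
  then show ?thesis
    using assms(1) by (simp add: j_eq prefix_num_Suc digit_shift_def marks_def algebra_simps)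
qed

lemma scramble_prefix_marks_iff_hits:
  assumes digits: "digit_seq d" and position: "j \<in> S" "j \<ge> 1"
    and synchronized: "[prefix_num d j = prefix_num (\<lambda>l. unscramble l (marks S l)) j + t] (mod P j)"
  shows "(\<forall>l\<in>{1..j}. \<sigma> l (d l) = marks (S - {j}) l) \<longleftrightarrow> hits j t"
proof -
  let ?e = "prefix_num (\<lambda>l. unscramble l (marks S l)) j"
  have "(\<forall>l\<in>{1..j}. \<sigma> l (d l) = marks (S - {j}) l) \<longleftrightarrow>
      [int (prefix_num d j) = int ?e + digit_shift j * int (P (j - 1))] (mod int (P j))"
    unfolding scramble_prefix_eq_iff[OF digits digit_seq_marks]
      prefix_num_unscramble_marks[OF position, symmetric] cong_int_iff ..
  also have "\<dots> \<longleftrightarrow> [int ?e + int t = int ?e + digit_shift j * int (P (j - 1))] (mod int (P j))"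
    using synchronized unfolding cong_int_iff[symmetric] by (simp add: cong_def)
  also have "\<dots> \<longleftrightarrow> hits j t"
    unfolding hits_def by (rule cong_add_lcancel)
  finally show ?thesis .
qed

definition scrambled_digits :: "real \<Rightarrow> nat \<Rightarrow> nat" where
  "scrambled_digits x j = \<sigma> j (cantor_digits q x j)"

lemma digit_scramble_eq_tail: "digit_scramble q \<sigma> x = tail (scrambled_digits x) 0"
  by (simp add: digit_scramble_def tail_def scrambled_digits_def)

lemma digit_seq_scrambled_digits: "x \<in> {0..<1} \<Longrightarrow> digit_seq (scrambled_digits x)"
  unfolding scrambled_digits_def by (intro digit_seq_scramble digit_seq_cantor_digits)

lemma eventually_max_scrambled_digits_funpow:
  assumes "x \<in> {0..<1}"
  shows "eventually_max (scrambled_digits ((odometer q ^^ n) x)) \<longleftrightarrow> eventually_max (scrambled_digits x)"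
proof (rule eventually_max_cong)
  show "\<forall>\<^sub>F j in sequentially. scrambled_digits ((odometer q ^^ n) x) j = scrambled_digits x j"
    using cantor_digits_funpow_eventually_eq[OF assms, of n]
    by eventually_elim (simp add: scrambled_digits_def)
qed

text \<open>The points of an orbit have eventually equal digits, so that the same endpoint convention
  applies to all of them.\<close>

lemma orbit_in_initial_segment_iff:
  assumes x_in_unit: "x \<in> {0..<1}" and positions: "S \<subseteq> {1..n}"
  shows "digit_scramble q \<sigma> ((odometer q ^^ m) x) \<in>
      initial_segment (eventually_max (scrambled_digits x)) (\<Sum>j\<in>S. 1 / real (P j)) \<longleftrightarrow>
    lex_less (scrambled_digits ((odometer q ^^ m) x)) (marks S)"
proof -
  let ?e = "scrambled_digits ((odometer q ^^ m) x)"
  have digits: "digit_seq ?e"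
    by (intro digit_seq_scrambled_digits odometer_funpow_in_unit x_in_unit)
  have marks_not_max: "\<not> eventually_max (marks S)"
    using positions finite_subset by (intro not_eventually_max_marks) blast
  have "lex_less ?e (marks S) \<longleftrightarrow>
      (if eventually_max ?e then tail ?e 0 \<le> tail (marks S) 0 else tail ?e 0 < tail (marks S) 0)"
    using lex_less_iff_tail_le[OF digits digit_seq_marks _ marks_not_max]
      lex_less_iff_tail_less[OF digits digit_seq_marks _ marks_not_max] by simp
  then show ?thesis
    unfolding digit_scramble_eq_tail tail_marks[OF positions]
      eventually_max_scrambled_digits_funpow[OF x_in_unit]
    using tail_nonneg[OF digits, of 0] by (auto simp: initial_segment_def)
qed

lemma orbit_hits_obtains:
  assumes x_in_unit: "x \<in> {0..<1}" and positions: "S \<subseteq> {1..n}"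
  obtains incl Z where
    "\<And>M t. [M = Z] (mod P n) \<Longrightarrow>
       indicator (initial_segment incl (\<Sum>j\<in>S. 1 / real (P j)))
         (digit_scramble q \<sigma> ((odometer q ^^ (M + t)) x)) = (\<Sum>j\<in>S. of_bool (hits j t) :: real)"
proof -
  define e where "e = (\<lambda>l. unscramble l (marks S l))"
  obtain Z where synchronized: "\<And>M t j. [M = Z] (mod P n) \<Longrightarrow> j \<le> n \<Longrightarrow>
      [prefix_num (cantor_digits q ((odometer q ^^ (M + t)) x)) j = prefix_num e j + t] (mod P j)"
    using synchronizing_time_obtains[OF x_in_unit] by blast
  have "indicator (initial_segment (eventually_max (scrambled_digits x)) (\<Sum>j\<in>S. 1 / real (P j)))
      (digit_scramble q \<sigma> ((odometer q ^^ (M + t)) x)) = (\<Sum>j\<in>S. of_bool (hits j t) :: real)"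
    if M_cong: "[M = Z] (mod P n)" for M t
  proof -
    let ?d = "cantor_digits q ((odometer q ^^ (M + t)) x)"
    have "indicator (initial_segment (eventually_max (scrambled_digits x)) (\<Sum>j\<in>S. 1 / real (P j)))
        (digit_scramble q \<sigma> ((odometer q ^^ (M + t)) x)) =
        (of_bool (lex_less (\<lambda>j. \<sigma> j (?d j)) (marks S)) :: real)"
      using orbit_in_initial_segment_iff[OF x_in_unit positions, of "M + t"]
      by (simp add: indicator_def scrambled_digits_def[abs_def])
    also have "\<dots> = (\<Sum>j\<in>S. of_bool (\<forall>l\<in>{1..j}. \<sigma> l (?d l) = marks (S - {j}) l))"
      using positions finite_subset by (intro of_bool_lex_less_marks) auto
    also have "\<dots> = (\<Sum>j\<in>S. of_bool (hits j t))"
    proof (intro sum.cong refl arg_cong[where f = of_bool] scramble_prefix_marks_iff_hits)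
      fix j assume "j \<in> S"
      then have "j \<ge> 1" "j \<le> n" using positions by auto
      then show "j \<ge> 1" "[prefix_num ?d j = prefix_num (\<lambda>l. unscramble l (marks S l)) j + t] (mod P j)"
        using synchronized[OF M_cong] unfolding e_def by auto
    qed (use digit_seq_cantor_digits[OF odometer_funpow_in_unit[OF x_in_unit]] in auto)
    finally show ?thesis .
  qed
  then show ?thesis using that by blast
qed

end

section \<open>Star discrepancy\<close>

definition mixed_box :: "('d \<Rightarrow> bool) \<Rightarrow> real ^ 'd \<Rightarrow> (real ^ 'd::finite) set" where
  "mixed_box w y = {z. \<forall>i. z $ i \<in> initial_segment (w i) (y $ i)}"

definition mixed_discrepancy ::
  "('d \<Rightarrow> bool) \<Rightarrow> real ^ 'd \<Rightarrow> (nat \<Rightarrow> real ^ 'd::finite) \<Rightarrow> nat \<Rightarrow> real" where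
  "mixed_discrepancy w y \<beta> N = (\<Sum>n = 1..N. indicator (mixed_box w y) (\<beta> n) - (\<Prod>i\<in>UNIV. y $ i))"

lemma abs_local_discrepancy_le:
  fixes y :: "real ^ 'd::finite"
  assumes "\<And>i. y $ i \<in> {0<..1}"
  shows "\<bar>local_discrepancy y \<beta> N\<bar> \<le> real N"
proof -
  have "0 \<le> (\<Prod>i\<in>UNIV. y $ i)" "(\<Prod>i\<in>UNIV. y $ i) \<le> 1"
    using assms by (auto intro!: prod_nonneg prod_le_1 simp: less_imp_le)
  then have "\<bar>indicator (anchored_box y) (\<beta> n) - (\<Prod>i\<in>UNIV. y $ i)\<bar> \<le> 1" for n
    by (auto simp: indicator_def)
  then have "(\<Sum>n = 1..N. \<bar>indicator (anchored_box y) (\<beta> n) - (\<Prod>i\<in>UNIV. y $ i)\<bar>) \<le> (\<Sum>n = 1..N. 1)"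
    by (intro sum_mono)
  then show ?thesis
    unfolding local_discrepancy_def using order_trans[OF sum_abs] by simp
qed

lemma abs_local_discrepancy_le_star:
  fixes y :: "real ^ 'd::finite"
  assumes "\<And>i. y $ i \<in> {0<..1}"
  shows "\<bar>local_discrepancy y \<beta> N\<bar> \<le> real N * star_discrepancy \<beta> N"
proof (cases "N = 0")
  case True
  then show ?thesis by (simp add: local_discrepancy_def)
next
  case False
  have "bdd_above ((\<lambda>y. \<bar>local_discrepancy y \<beta> N / real N\<bar>) ` {y. \<forall>i. y $ i \<in> {0<..1}})"
    by (intro bdd_aboveI2[where M = 1]) (use abs_local_discrepancy_le[of _ \<beta> N] False in simp)
  then have "\<bar>local_discrepancy y \<beta> N / real N\<bar> \<le> star_discrepancy \<beta> N"
    unfolding star_discrepancy_def using assms by (intro cSUP_upper) auto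
  then show ?thesis using False by (simp add: field_simps)
qed

lemma eventually_less_add_iff_le:
  fixes a b :: real
  shows "\<forall>\<^sub>F \<epsilon> in at_right 0. a < b + \<epsilon> \<longleftrightarrow> a \<le> b"
proof (cases "a \<le> b")
  case True
  then show ?thesis
    by (intro eventually_mono[OF eventually_at_right_less]) auto
next
  case False
  then have "\<forall>\<^sub>F \<epsilon> in at_right 0. \<epsilon> \<in> {0<..<a - b}"
    by (intro eventually_at_right_real) auto
  then show ?thesis
    by eventually_elim (use False in auto)
qed

definition enlarge :: "('d \<Rightarrow> bool) \<Rightarrow> real ^ 'd \<Rightarrow> real \<Rightarrow> real ^ 'd::finite" where
  "enlarge w y \<epsilon> = (\<chi> i. if w i then y $ i + \<epsilon> else y $ i)"

lemma eventually_enlarge_in_unit: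
  assumes "\<And>i. y $ i \<in> {0<..<1}"
  shows "\<forall>\<^sub>F \<epsilon> in at_right 0. \<forall>i. enlarge w y \<epsilon> $ i \<in> {0<..1}"
proof -
  have "\<forall>\<^sub>F \<epsilon> in at_right 0. \<forall>i\<in>UNIV. enlarge w y \<epsilon> $ i \<in> {0<..1}"
  proof (intro eventually_ball_finite ballI)
    fix i
    have "\<forall>\<^sub>F \<epsilon> in at_right 0. \<epsilon> \<in> {0<..<1 - y $ i}"
      using assms[of i] by (intro eventually_at_right_real) auto
    then show "\<forall>\<^sub>F \<epsilon> in at_right 0. enlarge w y \<epsilon> $ i \<in> {0<..1}"
      by eventually_elim (use assms[of i] in \<open>auto simp: enlarge_def\<close>)
  qed simp
  then show ?thesis by simp
qed

lemma eventually_local_discrepancy_enlarge: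
  "\<forall>\<^sub>F \<epsilon> in at_right 0. local_discrepancy (enlarge w y \<epsilon>) \<beta> N =
     (\<Sum>n = 1..N. indicator (mixed_box w y) (\<beta> n) - (\<Prod>i\<in>UNIV. enlarge w y \<epsilon> $ i))"
proof -
  have "\<forall>\<^sub>F \<epsilon> in at_right 0. \<forall>n\<in>{1..N}. \<forall>i\<in>UNIV.
      \<beta> n $ i \<in> {0..<enlarge w y \<epsilon> $ i} \<longleftrightarrow> \<beta> n $ i \<in> initial_segment (w i) (y $ i)"
  proof (intro eventually_ball_finite ballI)
    fix n i
    show "\<forall>\<^sub>F \<epsilon> in at_right 0.
        \<beta> n $ i \<in> {0..<enlarge w y \<epsilon> $ i} \<longleftrightarrow> \<beta> n $ i \<in> initial_segment (w i) (y $ i)"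
      using eventually_less_add_iff_le[of "\<beta> n $ i" "y $ i"]
      by eventually_elim (auto simp: enlarge_def initial_segment_def)
  qed auto
  then show ?thesis
    by eventually_elim
      (auto simp: local_discrepancy_def anchored_box_def mixed_box_def indicator_def intro!: sum.cong)
qed

lemma abs_mixed_discrepancy_le_star:
  fixes y :: "real ^ 'd::finite"
  assumes y_in_unit: "\<And>i. y $ i \<in> {0<..<1}"
  shows "\<bar>mixed_discrepancy w y \<beta> N\<bar> \<le> real N * star_discrepancy \<beta> N"
proof -
  let ?D = "\<lambda>\<epsilon>. \<Sum>n = 1..N. indicator (mixed_box w y) (\<beta> n) - (\<Prod>i\<in>UNIV. enlarge w y \<epsilon> $ i)"
  have "\<forall>\<^sub>F \<epsilon> in at_right 0. \<bar>?D \<epsilon>\<bar> \<le> real N * star_discrepancy \<beta> N"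
    using eventually_enlarge_in_unit[OF y_in_unit, of w] eventually_local_discrepancy_enlarge[of w y \<beta> N]
    by eventually_elim (use abs_local_discrepancy_le_star[of _ \<beta> N] in metis)
  moreover have "((\<lambda>\<epsilon>. enlarge w y \<epsilon> $ i) \<longlongrightarrow> y $ i) (at_right 0)" for i
    unfolding enlarge_def by (cases "w i") (auto intro!: tendsto_eq_intros)
  then have "((\<lambda>\<epsilon>. \<bar>?D \<epsilon>\<bar>) \<longlongrightarrow> \<bar>mixed_discrepancy w y \<beta> N\<bar>) (at_right 0)"
    unfolding mixed_discrepancy_def
    by (intro tendsto_rabs tendsto_sum tendsto_diff tendsto_const tendsto_prod)
  ultimately show ?thesis
    by (intro tendsto_upperbound) auto
qed

section \<open>Residue classes\<close>

lemma residue_class_eq_image: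
  fixes A p u :: nat
  assumes "A \<in> {1..p}"
  shows "{t \<in> {1..p * u}. [t = A] (mod p)} = (\<lambda>v. A + p * v) ` {..<u}"
proof (intro equalityI subsetI)
  fix t assume t_in_class: "t \<in> {t \<in> {1..p * u}. [t = A] (mod p)}"
  then have "[(t - 1) + 1 = (A - 1) + 1] (mod p)" using assms by simp
  then have "[t - 1 = A - 1] (mod p)" unfolding cong_add_rcancel_nat .
  moreover have "A - 1 < p" using assms by auto
  ultimately have "(t - 1) mod p = A - 1" by (simp add: cong_def)
  then have "t - 1 = p * ((t - 1) div p) + (A - 1)" by (metis mult_div_mod_eq)
  then have "t = A + p * ((t - 1) div p)" using t_in_class assms by auto
  moreover have "(t - 1) div p < u"
    using t_in_class by (intro less_mult_imp_div_less) (auto simp: mult.commute)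
  ultimately show "t \<in> (\<lambda>v. A + p * v) ` {..<u}" by blast
next
  fix t assume "t \<in> (\<lambda>v. A + p * v) ` {..<u}"
  then obtain v where t_eq: "v < u" "t = A + p * v" by auto
  have "p * (v + 1) \<le> p * u" using t_eq by (intro mult_le_mono2) auto
  then show "t \<in> {t \<in> {1..p * u}. [t = A] (mod p)}"
    using t_eq assms by (auto simp: cong_def)
qed

lemma sum_partial_sums:
  fixes a :: "nat \<Rightarrow> 'a :: comm_ring_1"
  shows "(\<Sum>M=1..m. \<Sum>t=1..M. a t) = (\<Sum>t=1..m. a t * (of_nat m + 1 - of_nat t))"
proof (induction m)
  case (Suc m)
  have "(\<Sum>t=1..m. a t * (of_nat (Suc m) + 1 - of_nat t)) =
      (\<Sum>t=1..m. a t * (of_nat m + 1 - of_nat t)) + (\<Sum>t=1..m. a t)"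
    by (simp add: sum.distrib[symmetric] algebra_simps)
  then show ?case using Suc by simp
qed simp

lemma residue_class_weighted_sum:
  fixes A p u :: nat and c :: real
  assumes "A \<in> {1..p}"
  shows "(\<Sum>t=1..p * u. of_bool ([t = A] (mod p)) * (c - real t)) =
    real u * (c - real A) - real p * (real u * (real u - 1) / 2)"
proof -
  have "(\<Sum>t=1..p * u. of_bool ([t = A] (mod p)) * (c - real t)) =
      (\<Sum>t\<in>{t\<in>{1..p * u}. [t = A] (mod p)}. c - real t)"
    by (intro sum.mono_neutral_cong_right) auto
  also have "\<dots> = (\<Sum>v<u. c - real (A + p * v))"
    unfolding residue_class_eq_image[OF assms] using assms by (subst sum.reindex) (auto simp: inj_on_def)
  also have "\<dots> = real u * (c - real A) - real p * (\<Sum>v<u. real v)"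
    by (simp add: algebra_simps sum.distrib sum_subtractf sum_distrib_left)
  also have "(\<Sum>v<u. real v) = real u * (real u - 1) / 2"
    by (induction u) (auto simp: field_simps)
  finally show ?thesis .
qed

lemma residue_class_average:
  fixes A p m :: nat
  assumes A_range: "A \<in> {1..p}" and "p dvd m"
  shows "(\<Sum>M=1..m. \<Sum>t=1..M. of_bool ([t = A] (mod p)) - 1 / real p) =
    real m * (1/2 - real A / real p + 1 / (2 * real p))"
proof -
  obtain u where m_eq: "m = p * u" using assms(2) by auto
  have p_pos: "real p > 0" using A_range by auto
  let ?c = "real m + 1"
  have total_weight: "(\<Sum>t=1..m. ?c - real t) = real m * ?c / 2"
    using residue_class_weighted_sum[of 1 1 ?c m]
    by (simp add: algebra_simps add_divide_distrib diff_divide_distrib)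
  have "(\<Sum>M=1..m. \<Sum>t=1..M. of_bool ([t = A] (mod p)) - 1 / real p) =
      (\<Sum>t=1..m. of_bool ([t = A] (mod p)) * (?c - real t)) - 1 / real p * (\<Sum>t=1..m. ?c - real t)"
    unfolding sum_partial_sums sum_distrib_left by (simp only: left_diff_distrib sum_subtractf)
  also have "\<dots> = real u * (?c - real A) - real p * (real u * (real u - 1) / 2) -
      1 / real p * (real m * ?c / 2)"
    unfolding total_weight using residue_class_weighted_sum[OF A_range, of ?c u] m_eq by simp
  also have "\<dots> = real m * (1/2 - real A / real p + 1 / (2 * real p))"
    using p_pos unfolding m_eq by (simp add: field_simps)
  finally show ?thesis .
qed

lemma cong_prod_iff:
  fixes m :: "'a \<Rightarrow> nat"
  assumes "finite I" "\<And>i j. i \<in> I \<Longrightarrow> j \<in> I \<Longrightarrow> i \<noteq> j \<Longrightarrow> coprime (m i) (m j)"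
  shows "[a = b] (mod (\<Prod>i\<in>I. m i)) \<longleftrightarrow> (\<forall>i\<in>I. [a = b] (mod m i))"
proof
  assume "[a = b] (mod (\<Prod>i\<in>I. m i))"
  then show "\<forall>i\<in>I. [a = b] (mod m i)"
    using assms(1) by (meson cong_dvd_modulus_nat dvd_prodI)
next
  assume "\<forall>i\<in>I. [a = b] (mod m i)"
  then show "[a = b] (mod (\<Prod>i\<in>I. m i))"
    using assms(2) by (intro coprime_cong_prod_nat) auto
qed

lemma ex_nat_cong_mult:
  fixes u n :: nat and \<delta> :: int
  assumes "coprime u n" "n > 0"
  shows "\<exists>v::nat. [int (v * u) = \<delta>] (mod int n)"
proof -
  obtain x where inverse_cong: "[int u * x = 1] (mod int n)"
    using cong_solve_coprime_int[of "int u" "int n"] assms(1) by auto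
  have "[int (nat (x * \<delta> mod int n) * u) = x * \<delta> * int u] (mod int n)"
    using assms(2) by (simp add: cong_def mod_mult_left_eq)
  also have "[x * \<delta> * int u = \<delta>] (mod int n)"
    using cong_mult[OF inverse_cong cong_refl[of \<delta>]] by (simp add: mult_ac)
  finally show ?thesis by (rule exI)
qed

definition cofactor :: "'a set \<Rightarrow> ('a \<Rightarrow> nat) \<Rightarrow> 'a \<Rightarrow> nat" where
  "cofactor I m i = (\<Prod>l\<in>I-{i}. m l)"

lemma prod_eq_mult_cofactor: "finite I \<Longrightarrow> i \<in> I \<Longrightarrow> (\<Prod>l\<in>I. m l) = m i * cofactor I m i"
  by (simp add: cofactor_def prod.remove)

lemma cofactor_residue_obtains:
  fixes m q :: "'a \<Rightarrow> nat" and \<delta> :: "'a \<Rightarrow> int"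
  assumes "finite I" and q_pos: "\<And>i. i \<in> I \<Longrightarrow> q i > 0"
    and coprime_factors: "\<And>i j. i \<in> I \<Longrightarrow> j \<in> I \<Longrightarrow> i \<noteq> j \<Longrightarrow> coprime (m i * q i) (m j * q j)"
  obtains r where "r < (\<Prod>i\<in>I. q i)"
    "\<And>i. i \<in> I \<Longrightarrow> [int (r * cofactor I m i) = \<delta> i] (mod int (q i))"
proof -
  have "\<exists>v. [int (v * cofactor I m i) = \<delta> i] (mod int (q i))" if "i \<in> I" for i
  proof (rule ex_nat_cong_mult)
    show "coprime (cofactor I m i) (q i)"
      unfolding cofactor_def using coprime_factors that by (intro prod_coprime_left) auto
  qed (use q_pos that in auto)
  then obtain v where v_cong: "\<And>i. i \<in> I \<Longrightarrow> [int (v i * cofactor I m i) = \<delta> i] (mod int (q i))"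
    by metis
  have "\<exists>!r. r < (\<Prod>i\<in>I. q i) \<and> (\<forall>i\<in>I. [r = v i] (mod q i))"
    using assms by (intro chinese_remainder_unique_nat) auto
  then obtain r where r_cong: "r < (\<Prod>i\<in>I. q i)" "\<forall>i\<in>I. [r = v i] (mod q i)"
    by blast
  have "[int (r * cofactor I m i) = \<delta> i] (mod int (q i))" if "i \<in> I" for i
  proof -
    have "[int (r * cofactor I m i) = int (v i * cofactor I m i)] (mod int (q i))"
      unfolding cong_int_iff using r_cong(2) that by (intro cong_mult cong_refl) auto
    then show ?thesis using v_cong[OF that] by (rule cong_trans)
  qed
  then show ?thesis using r_cong(1) that by blast
qed

lemma cong_cofactor_iff:
  fixes m q :: "'a \<Rightarrow> nat" and \<delta> :: "'a \<Rightarrow> int"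
  assumes "finite I"
    and coprime_factors: "\<And>i j. i \<in> I \<Longrightarrow> j \<in> I \<Longrightarrow> i \<noteq> j \<Longrightarrow> coprime (m i * q i) (m j * q j)"
    and r_cong: "\<And>i. i \<in> I \<Longrightarrow> [int (r * cofactor I m i) = \<delta> i] (mod int (q i))"
  shows "(\<forall>i\<in>I. [int t = \<delta> i * int (m i)] (mod int (m i * q i))) \<longleftrightarrow>
    [t = r * (\<Prod>i\<in>I. m i)] (mod (\<Prod>i\<in>I. m i * q i))"
proof -
  let ?A = "r * (\<Prod>i\<in>I. m i)"
  have "[int t = \<delta> i * int (m i)] (mod int (m i * q i)) \<longleftrightarrow> [t = ?A] (mod m i * q i)" if "i \<in> I" for i
  proof -
    have A_eq: "?A = m i * (r * cofactor I m i)"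
      using \<open>finite I\<close> that by (simp add: prod_eq_mult_cofactor)
    have "[int ?A = \<delta> i * int (m i)] (mod int (m i * q i))"
      using cong_cmult_leftI[OF r_cong[OF that], of "int (m i)"]
      unfolding A_eq of_nat_mult by (simp only: mult.commute)
    then show ?thesis
      unfolding cong_int_iff[symmetric] by (auto simp: cong_def)
  qed
  then show ?thesis
    using cong_prod_iff[of I "\<lambda>i. m i * q i", OF \<open>finite I\<close> coprime_factors] by simp
qed

section \<open>Selecting digit positions\<close>

definition uniformly_signed :: "real \<Rightarrow> ('a \<Rightarrow> real) \<Rightarrow> 'a set \<Rightarrow> bool" where
  "uniformly_signed c f A \<longleftrightarrow> (\<forall>x\<in>A. c \<le> f x) \<or> (\<forall>x\<in>A. f x \<le> - c)"

lemma uniformly_signed_abs_sum_ge: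
  assumes "uniformly_signed c f A"
  shows "real (card A) * c \<le> \<bar>\<Sum>x\<in>A. f x\<bar>"
  using assms unfolding uniformly_signed_def
proof
  assume "\<forall>x\<in>A. c \<le> f x"
  then have "(\<Sum>x\<in>A. c) \<le> (\<Sum>x\<in>A. f x)" by (intro sum_mono) auto
  then show ?thesis by simp
next
  assume "\<forall>x\<in>A. f x \<le> - c"
  then have "(\<Sum>x\<in>A. f x) \<le> (\<Sum>x\<in>A. - c)" by (intro sum_mono) auto
  then show ?thesis by simp
qed

lemma uniformly_signed_abs_sum_PiE_ge:
  assumes "finite I" "uniformly_signed c f (PiE I S)" "c \<ge> 0"
    and "\<And>i. i \<in> I \<Longrightarrow> 0 \<le> g i" "\<And>i. i \<in> I \<Longrightarrow> g i \<le> real (card (S i))"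
  shows "(\<Prod>i\<in>I. g i) * c \<le> \<bar>\<Sum>k\<in>PiE I S. f k\<bar>"
proof -
  have "(\<Prod>i\<in>I. g i) \<le> real (card (PiE I S))"
    unfolding card_PiE[OF assms(1)] of_nat_prod using assms(4,5) by (intro prod_mono) auto
  then have "(\<Prod>i\<in>I. g i) * c \<le> real (card (PiE I S)) * c"
    using assms(3) by (rule mult_right_mono)
  also have "\<dots> \<le> \<bar>\<Sum>k\<in>PiE I S. f k\<bar>"
    by (rule uniformly_signed_abs_sum_ge[OF assms(2)])
  finally show ?thesis .
qed

lemma uniformly_signed_subset_obtains:
  assumes "finite A" "\<And>x. x \<in> A \<Longrightarrow> c \<le> \<bar>f x\<bar>"
  obtains B where "B \<subseteq> A" "card A \<le> 2 * card B" "uniformly_signed c f B"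
proof -
  define pos neg where "pos = {x\<in>A. f x > 0}" and "neg = {x\<in>A. f x \<le> 0}"
  have "A = pos \<union> neg" by (auto simp: pos_def neg_def)
  then have "card A \<le> card pos + card neg" by (simp add: card_Un_le)
  then consider "card A \<le> 2 * card pos" | "card A \<le> 2 * card neg" by linarith
  moreover have "uniformly_signed c f pos" "uniformly_signed c f neg"
    using assms(2) by (fastforce simp: uniformly_signed_def pos_def neg_def)+
  moreover have "pos \<subseteq> A" "neg \<subseteq> A" by (auto simp: pos_def neg_def)
  ultimately show ?thesis using that by metis
qed

lemma uniformly_signed_subset_no_majority_obtains:
  assumes "finite A"
    and no_majority: "\<And>a. 2 * card {x\<in>A. cl x = a} < card A"
    and small_same_class: "\<And>x y. x \<in> A \<Longrightarrow> y \<in> A \<Longrightarrow> \<bar>f x\<bar> < c \<Longrightarrow> \<bar>f y\<bar> < c \<Longrightarrow> cl x = cl y"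
  obtains B where "B \<subseteq> A" "card A < 4 * card B" "uniformly_signed c f B"
proof -
  define bad where "bad = {x\<in>A. \<bar>f x\<bar> < c}"
  obtain a where "bad \<subseteq> {x\<in>A. cl x = a}"
  proof (cases "bad = {}")
    case False
    then obtain y where "y \<in> bad" by blast
    then show ?thesis using that[of "cl y"] small_same_class by (auto simp: bad_def)
  qed (use that in auto)
  then have "card bad \<le> card {x\<in>A. cl x = a}"
    using assms(1) by (intro card_mono) auto
  then have card_bad: "2 * card bad < card A" using no_majority[of a] by linarith
  obtain B where signed_subset: "B \<subseteq> A - bad" "card (A - bad) \<le> 2 * card B" "uniformly_signed c f B"
  proof (rule uniformly_signed_subset_obtains)
    show "finite (A - bad)" using assms(1) by simp
    show "c \<le> \<bar>f x\<bar>" if "x \<in> A - bad" for x using that by (auto simp: bad_def)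
  qed
  have "card (A - bad) = card A - card bad"
    using assms(1) by (intro card_Diff_subset) (auto simp: bad_def)
  then have "card A < 4 * card B" using signed_subset(2) card_bad by linarith
  then show ?thesis using signed_subset that by blast
qed

lemma pigeonhole_fiber:
  assumes "finite A" "finite B" "f \<in> A \<rightarrow> B" "card B \<le> c"
  shows "\<exists>b. card A \<le> c * card {a \<in> A. f a = b}"
proof (cases "A = {}")
  case False
  then obtain b where "card A \<le> card (f -` {b} \<inter> A) * card B"
    using pigeonhole_card[OF assms(3,1,2)] assms(3) by auto
  also have "f -` {b} \<inter> A = {a \<in> A. f a = b}" by auto
  also have "card {a \<in> A. f a = b} * card B \<le> c * card {a \<in> A. f a = b}"
    using assms(4) by (simp add: mult.commute)
  finally show ?thesis by blast
qed simp

locale coprime_moduli =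
  fixes q :: "'d::finite \<Rightarrow> nat"
  assumes card_ge_2: "CARD('d) \<ge> 2"
    and modulus_ge_2: "q i \<ge> 2"
    and coprime_moduli: "i \<noteq> j \<Longrightarrow> coprime (q i) (q j)"
begin

definition Q :: nat where
  "Q = (\<Prod>i\<in>UNIV. q i)"

lemma Q_eq: "Q = q i * cofactor UNIV q i"
  by (simp add: Q_def prod_eq_mult_cofactor)

lemma modulus_pos: "q i > 0"
  using modulus_ge_2[of i] by simp

lemma Q_pos: "Q > 0"
  by (simp add: Q_def modulus_pos)

text \<open>This is where at least two coordinates are needed: some modulus is odd, and it would
  divide \<open>Q = 2 r\<close>, hence \<open>r\<close>.\<close>

lemma twice_neq_Q:
  assumes "\<And>i. \<not> q i dvd r"
  shows "2 * r \<noteq> Q"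
proof
  assume twice_eq: "2 * r = Q"
  obtain i j :: 'd where "i \<noteq> j"
    using card_ge_2 card_le_Suc0_iff_eq[of "UNIV :: 'd set"] by auto
  then have "odd (q i) \<or> odd (q j)"
    using coprime_moduli[of i j] coprime_common_divisor by fastforce
  then obtain i where "odd (q i)" by blast
  then have "coprime (q i) 2" by simp
  moreover have "q i dvd 2 * r" unfolding twice_eq Q_eq[of i] by simp
  ultimately have "q i dvd r" by (simp add: coprime_dvd_mult_right_iff)
  with assms show False by blast
qed

lemma abs_half_minus_ge:
  assumes "\<And>i. \<not> q i dvd r"
  shows "1 / (2 * real Q) \<le> \<bar>1/2 - real r / real Q\<bar>"
proof -
  have "1 \<le> \<bar>real Q - 2 * real r\<bar>" using twice_neq_Q[OF assms] by linarith
  then have "1 / (2 * real Q) \<le> \<bar>real Q - 2 * real r\<bar> / (2 * real Q)"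
    by (intro divide_right_mono) auto
  also have "\<dots> = \<bar>(real Q - 2 * real r) / (2 * real Q)\<bar>"
    by (simp add: abs_divide)
  also have "(real Q - 2 * real r) / (2 * real Q) = 1/2 - real r / real Q"
    using Q_pos by (simp add: field_simps)
  finally show ?thesis .
qed

lemma near_half_unique:
  assumes same_residue: "[a = b] (mod cofactor UNIV q i)"
    and a_near: "\<bar>1/2 - real a / real Q\<bar> < 1 / (2 * real (q i))"
    and b_near: "\<bar>1/2 - real b / real Q\<bar> < 1 / (2 * real (q i))"
  shows "a = b"
proof -
  have "\<bar>real a / real Q - real b / real Q\<bar> < 1 / real (q i)"
  proof -
    have "1 / real (q i) = 1 / (2 * real (q i)) + 1 / (2 * real (q i))" by simp
    then show ?thesis using a_near b_near by linarith
  qed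
  then have "\<bar>real a - real b\<bar> / real Q < 1 / real (q i)"
    by (simp add: diff_divide_distrib[symmetric] abs_divide)
  then have "\<bar>real a - real b\<bar> < real Q / real (q i)"
    using Q_pos modulus_pos[of i] by (simp add: field_simps)
  also have "\<dots> = real (cofactor UNIV q i)"
    unfolding Q_eq[of i] using modulus_pos[of i] by simp
  finally have "\<bar>int a - int b\<bar> < int (cofactor UNIV q i)" by linarith
  moreover have "int (cofactor UNIV q i) dvd int a - int b"
    using same_residue by (simp add: cong_iff_dvd_diff flip: cong_int_iff)
  ultimately have "int a - int b = 0"
    by (metis dvd_imp_le_int not_le abs_of_nat)
  then show ?thesis by simp
qed

end

locale residue_family = coprime_moduli q for q :: "'d::finite \<Rightarrow> nat" +
  fixes J :: "'d \<Rightarrow> 'a set" and r :: "('d \<Rightarrow> 'a) \<Rightarrow> nat" and c :: "'d \<Rightarrow> 'a \<Rightarrow> nat"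
  assumes finite_J: "finite (J i)" and J_nonempty: "J i \<noteq> {}"
    and r_less: "k \<in> PiE UNIV J \<Longrightarrow> r k < Q"
    and residue: "k \<in> PiE UNIV J \<Longrightarrow> r k mod q i = c i (k i)"
    and residue_neq_0: "j \<in> J i \<Longrightarrow> c i j \<noteq> 0"
begin

definition deviation :: "('d \<Rightarrow> 'a) \<Rightarrow> real" where
  "deviation k = 1/2 - real (r k) / real Q"

definition fiber :: "'d \<Rightarrow> nat \<Rightarrow> 'a set" where
  "fiber i a = {j\<in>J i. c i j = a}"

lemma r_eqI:
  assumes "k \<in> PiE UNIV J" "k' \<in> PiE UNIV J" "\<And>i. c i (k i) = c i (k' i)"
  shows "r k = r k'"
proof -
  have "[r k = r k'] (mod Q)"
    unfolding Q_def using assms residue coprime_moduli by (subst cong_prod_iff) (auto simp: cong_def)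
  then show ?thesis using r_less assms(1,2) by (simp add: cong_def)
qed

lemma not_dvd_r: "k \<in> PiE UNIV J \<Longrightarrow> \<not> q i dvd r k"
  using residue[of k i] residue_neq_0[of "k i" i] by (auto simp: dvd_eq_mod_eq_0)

lemma card_J_pos: "card (J i) > 0"
  using finite_J J_nonempty by (simp add: card_gt_0_iff)

lemma ex_frequent_fiber: "\<exists>a. card (J i) \<le> q i * card (fiber i a)"
  unfolding fiber_def
proof (rule pigeonhole_fiber)
  have "PiE UNIV J \<noteq> {}" using J_nonempty by (simp add: PiE_eq_empty_iff)
  then obtain k where k_in: "k \<in> PiE UNIV J" by blast
  show "c i \<in> J i \<rightarrow> {..<q i}"
  proof
    fix j assume "j \<in> J i"
    then have "k(i := j) \<in> PiE UNIV J" using k_in by (simp add: PiE_iff)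
    from residue[OF this, of i] have "c i j = r (k(i := j)) mod q i" by simp
    then show "c i j \<in> {..<q i}" using modulus_pos by simp
  qed
qed (use finite_J in auto)

lemma select_majority_obtains:
  assumes "\<And>i. \<exists>a. card (J i) \<le> 2 * card (fiber i a)"
  obtains S where "\<And>i. S i \<subseteq> J i" "\<And>i. real (card (J i)) / 2 \<le> real (card (S i))"
    "uniformly_signed (1 / (2 * real Q)) deviation (PiE UNIV S)"
proof -
  obtain a where majority: "\<And>i. card (J i) \<le> 2 * card (fiber i (a i))"
    using assms by metis
  define S where "S i = fiber i (a i)" for i
  have S_subset: "S i \<subseteq> J i" for i by (auto simp: S_def fiber_def)
  have "\<exists>j. j \<in> S i" for i
    using majority[of i] card_J_pos[of i] by (metis S_def card.empty ex_in_conv mult_0_right not_le)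
  then obtain k\<^sub>0 where k\<^sub>0_in_S: "\<And>i. k\<^sub>0 i \<in> S i" by metis
  then have k\<^sub>0_in_J: "k\<^sub>0 \<in> PiE UNIV J" using S_subset by (auto simp: PiE_iff)
  have "deviation k = deviation k\<^sub>0" if "k \<in> PiE UNIV S" for k
  proof -
    have "k i \<in> S i" for i using that by (simp add: PiE_iff)
    then have "r k = r k\<^sub>0"
      using k\<^sub>0_in_S S_subset by (intro r_eqI k\<^sub>0_in_J) (auto simp: PiE_iff S_def fiber_def)
    then show ?thesis by (simp add: deviation_def)
  qed
  moreover have "1 / (2 * real Q) \<le> \<bar>deviation k\<^sub>0\<bar>"
    unfolding deviation_def using not_dvd_r[OF k\<^sub>0_in_J] by (rule abs_half_minus_ge)
  ultimately have "uniformly_signed (1 / (2 * real Q)) deviation (PiE UNIV S)"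
    by (auto simp: uniformly_signed_def abs_if split: if_splits)
  moreover have "real (card (J i)) / 2 \<le> real (card (S i))" for i
    using majority[of i] by (simp add: S_def)
  ultimately show ?thesis using S_subset that[of S] by blast
qed

lemma uniformly_signed_slice_obtains:
  assumes k_in: "k \<in> PiE UNIV J" and no_majority: "\<And>a. 2 * card (fiber i a) < card (J i)"
  obtains B where "B \<subseteq> J i" "card (J i) < 4 * card B"
    "uniformly_signed (1 / (2 * real (q i))) (\<lambda>j. deviation (k(i := j))) B"
proof (rule uniformly_signed_subset_no_majority_obtains[where cl = "c i"])
  fix j j'
  assume j_in: "j \<in> J i" "j' \<in> J i"
    and near_half: "\<bar>deviation (k(i := j))\<bar> < 1 / (2 * real (q i))"
      "\<bar>deviation (k(i := j'))\<bar> < 1 / (2 * real (q i))"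
  have update_in: "k(i := j) \<in> PiE UNIV J" "k(i := j') \<in> PiE UNIV J"
    using k_in j_in by (auto simp: PiE_iff)
  have "[r (k(i := j)) = r (k(i := j'))] (mod q l)" if "l \<noteq> i" for l
    using residue[OF update_in(1), of l] residue[OF update_in(2), of l] that by (simp add: cong_def)
  then have "[r (k(i := j)) = r (k(i := j'))] (mod cofactor UNIV q i)"
    unfolding cofactor_def using coprime_moduli by (intro coprime_cong_prod_nat) auto
  then have "r (k(i := j)) = r (k(i := j'))"
    using near_half unfolding deviation_def by (rule near_half_unique)
  then show "c i j = c i j'"
    using residue[OF update_in(1), of i] residue[OF update_in(2), of i] by simp
qed (use that finite_J no_majority in \<open>auto simp: fiber_def\<close>)

lemma select_no_majority_obtains:
  assumes no_majority: "\<And>a. 2 * card (fiber i\<^sub>0 a) < card (J i\<^sub>0)"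
  obtains S where "\<And>i. S i \<subseteq> J i" "real (card (J i\<^sub>0)) / 4 \<le> real (card (S i\<^sub>0))"
    "\<And>i. i \<noteq> i\<^sub>0 \<Longrightarrow> real (card (J i)) / real (q i) \<le> real (card (S i))"
    "uniformly_signed (1 / (2 * real (q i\<^sub>0))) deviation (PiE UNIV S)"
proof -
  obtain a where frequent: "\<And>i. card (J i) \<le> q i * card (fiber i (a i))"
    using ex_frequent_fiber by metis
  have fiber_sub: "fiber i (a i) \<subseteq> J i" for i by (auto simp: fiber_def)
  have "\<exists>j. j \<in> fiber i (a i)" for i
    using frequent[of i] card_J_pos[of i] by (metis card.empty ex_in_conv mult_0_right not_le)
  then obtain k\<^sub>0 where k\<^sub>0_in_fiber: "\<And>i. k\<^sub>0 i \<in> fiber i (a i)" by metis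
  then have k\<^sub>0_in_J: "k\<^sub>0 \<in> PiE UNIV J" using fiber_sub by (auto simp: PiE_iff)
  obtain B where slice: "B \<subseteq> J i\<^sub>0" "card (J i\<^sub>0) < 4 * card B"
    "uniformly_signed (1 / (2 * real (q i\<^sub>0))) (\<lambda>j. deviation (k\<^sub>0(i\<^sub>0 := j))) B"
    by (rule uniformly_signed_slice_obtains[OF k\<^sub>0_in_J no_majority])
  define S where "S i = (if i = i\<^sub>0 then B else fiber i (a i))" for i
  have S_subset: "S i \<subseteq> J i" for i using slice(1) fiber_sub by (simp add: S_def)
  have dev_eq: "deviation k = deviation (k\<^sub>0(i\<^sub>0 := k i\<^sub>0)) \<and> k i\<^sub>0 \<in> B" if "k \<in> PiE UNIV S" for k
  proof -
    have k_in_S: "k i \<in> S i" for i using that by (simp add: PiE_iff)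
    have "r k = r (k\<^sub>0(i\<^sub>0 := k i\<^sub>0))"
    proof (rule r_eqI)
      show "k \<in> PiE UNIV J" using subsetD[OF S_subset k_in_S] by (simp add: PiE_iff)
      show "k\<^sub>0(i\<^sub>0 := k i\<^sub>0) \<in> PiE UNIV J" using k\<^sub>0_in_J subsetD[OF S_subset k_in_S] by (simp add: PiE_iff)
      show "c i (k i) = c i ((k\<^sub>0(i\<^sub>0 := k i\<^sub>0)) i)" for i
        using k_in_S[of i] k\<^sub>0_in_fiber[of i] by (auto simp: S_def fiber_def)
    qed
    then show ?thesis using k_in_S[of i\<^sub>0] by (simp add: deviation_def S_def)
  qed
  have "uniformly_signed (1 / (2 * real (q i\<^sub>0))) deviation (PiE UNIV S)"
    using slice(3) dev_eq unfolding uniformly_signed_def by metis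
  moreover have "real (card (J i)) / real (q i) \<le> real (card (S i))" if "i \<noteq> i\<^sub>0" for i
  proof -
    have "real (card (J i)) \<le> real (q i * card (fiber i (a i)))"
      using frequent[of i] unfolding of_nat_le_iff .
    then show ?thesis using that modulus_pos[of i] by (simp add: S_def divide_le_eq mult.commute)
  qed
  moreover have "real (card (J i\<^sub>0)) / 4 \<le> real (card (S i\<^sub>0))" using slice(2) by (simp add: S_def)
  ultimately show ?thesis using S_subset that[of S] by blast
qed

lemma majority_abs_sum_obtains:
  assumes "\<And>i. \<exists>a. card (J i) \<le> 2 * card (fiber i a)"
  obtains S where "\<And>i. S i \<subseteq> J i"
    "(\<Prod>i\<in>UNIV. real (card (J i))) / (2 ^ (CARD('d) + 1) * real Q) \<le> \<bar>\<Sum>k\<in>PiE UNIV S. deviation k\<bar>"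
proof -
  obtain S where selection: "\<And>i. S i \<subseteq> J i" "\<And>i. real (card (J i)) / 2 \<le> real (card (S i))"
    "uniformly_signed (1 / (2 * real Q)) deviation (PiE UNIV S)"
    using select_majority_obtains[OF assms] by blast
  have "(\<Prod>i\<in>(UNIV::'d set). real (card (J i)) / 2) * (1 / (2 * real Q)) \<le> \<bar>\<Sum>k\<in>PiE UNIV S. deviation k\<bar>"
    using selection(2,3) by (intro uniformly_signed_abs_sum_PiE_ge) auto
  then show ?thesis using selection(1) that[of S] by (simp add: prod_dividef)
qed

lemma no_majority_abs_sum_obtains:
  assumes "\<And>a. 2 * card (fiber i\<^sub>0 a) < card (J i\<^sub>0)"
  obtains S where "\<And>i. S i \<subseteq> J i"
    "(\<Prod>i\<in>UNIV. real (card (J i))) / (8 * real Q) \<le> \<bar>\<Sum>k\<in>PiE UNIV S. deviation k\<bar>"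
proof -
  obtain S where selection: "\<And>i. S i \<subseteq> J i" "real (card (J i\<^sub>0)) / 4 \<le> real (card (S i\<^sub>0))"
    "\<And>i. i \<noteq> i\<^sub>0 \<Longrightarrow> real (card (J i)) / real (q i) \<le> real (card (S i))"
    "uniformly_signed (1 / (2 * real (q i\<^sub>0))) deviation (PiE UNIV S)"
    using select_no_majority_obtains[OF assms] by blast
  let ?loss = "\<lambda>i. if i = i\<^sub>0 then 4 else real (q i)"
  have "(\<Prod>i\<in>UNIV. ?loss i) = 4 * real (cofactor UNIV q i\<^sub>0)"
    by (simp add: cofactor_def prod.remove[of UNIV i\<^sub>0])
  then have "(\<Prod>i\<in>UNIV. real (card (J i)) / ?loss i) * (1 / (2 * real (q i\<^sub>0))) =
      (\<Prod>i\<in>UNIV. real (card (J i))) / (8 * real Q)"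
    unfolding prod_dividef by (simp add: Q_eq[of i\<^sub>0])
  moreover have "(\<Prod>i\<in>UNIV. real (card (J i)) / ?loss i) * (1 / (2 * real (q i\<^sub>0))) \<le>
      \<bar>\<Sum>k\<in>PiE UNIV S. deviation k\<bar>"
    using selection(2-4) by (intro uniformly_signed_abs_sum_PiE_ge) auto
  ultimately show ?thesis using selection(1) that[of S] by simp
qed

text \<open>The deviation can be as small as \<open>1/(2Q)\<close>, but with all coordinates except \<open>i\<close> fixed it is
  smaller than \<open>1/(2 q\<^sub>i)\<close> for at most one residue. So either every coordinate has a residue attained on
  half of the positions, and these positions are taken, or in some coordinate the bad residue can be
  discarded.\<close>

lemma select_positions_obtains:
  obtains S where "\<And>i. S i \<subseteq> J i" "\<And>i. S i \<noteq> {}"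
    "(\<Prod>i\<in>UNIV. real (card (J i))) / (2 ^ (CARD('d) + 1) * real Q) \<le> \<bar>\<Sum>k\<in>PiE UNIV S. deviation k\<bar>"
proof -
  let ?N = "\<Prod>i\<in>UNIV. real (card (J i))"
  obtain S where selection: "\<And>i. S i \<subseteq> J i"
    "?N / (2 ^ (CARD('d) + 1) * real Q) \<le> \<bar>\<Sum>k\<in>PiE UNIV S. deviation k\<bar>"
  proof (cases "\<forall>i. \<exists>a. card (J i) \<le> 2 * card (fiber i a)")
    case True
    then show ?thesis using majority_abs_sum_obtains that by blast
  next
    case False
    then obtain i\<^sub>0 where "\<And>a. 2 * card (fiber i\<^sub>0 a) < card (J i\<^sub>0)" by (auto simp: not_le)
    then obtain S where signed_selection: "\<And>i. S i \<subseteq> J i"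
      "?N / (8 * real Q) \<le> \<bar>\<Sum>k\<in>PiE UNIV S. deviation k\<bar>"
      using no_majority_abs_sum_obtains by blast
    have "?N / (2 ^ (CARD('d) + 1) * real Q) \<le> ?N / (8 * real Q)"
    proof (intro divide_left_mono mult_right_mono)
      have "(2::real) ^ 3 \<le> 2 ^ (CARD('d) + 1)"
        using card_ge_2 by (intro power_increasing) auto
      then show "(8::real) \<le> 2 ^ (CARD('d) + 1)" by simp
    qed (use Q_pos in \<open>auto intro!: prod_nonneg\<close>)
    then show ?thesis using signed_selection that[of S] by simp
  qed
  have "0 < ?N / (2 ^ (CARD('d) + 1) * real Q)"
    using card_J_pos Q_pos by (intro divide_pos_pos prod_pos mult_pos_pos) auto
  then have "PiE UNIV S \<noteq> {}" using selection(2) by auto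
  then show ?thesis using selection that by (auto simp: PiE_eq_empty_iff)
qed

end

section \<open>The lower bound\<close>

lemma odometer_vec_funpow_nth: "(odometer_vec p ^^ n) x $ i = (odometer (p i) ^^ n) (x $ i)"
  by (induction n) (auto simp: odometer_vec_def)

lemma halton_nth: "halton p \<sigma> n x $ i = digit_scramble (p i) (\<sigma> i) ((odometer (p i) ^^ n) (x $ i))"
  by (simp add: halton_def digit_scramble_vec_def odometer_vec_funpow_nth)

lemma of_bool_all_eq_prod:
  "of_bool (\<forall>i. R i) = (\<Prod>i\<in>(UNIV::'d::finite set). of_bool (R i) :: 'a :: comm_semiring_1)"
  by (cases "\<forall>i. R i") (auto intro!: prod_zero)

lemma power_le_prod_div:
  fixes b k :: "'d::finite \<Rightarrow> nat"
  assumes n_le: "\<And>i. n \<le> h * cofactor UNIV b i * k i" and b_pos: "\<And>i. b i > 0" and h_pos: "h > 0"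
  shows "(real n / (2 * real h * real (\<Prod>i\<in>UNIV. b i))) ^ CARD('d) / 2 \<le>
    (\<Prod>i\<in>UNIV. real (k i)) / (2 ^ (CARD('d) + 1) * real (\<Prod>i\<in>UNIV. b i))"
proof -
  define B where "B = (\<Prod>i\<in>UNIV. b i)"
  have B_pos: "B > 0" using b_pos by (simp add: B_def)
  have "real n * real (b i) / (real h * real B) \<le> real (k i)" for i
  proof -
    have "n * b i \<le> h * cofactor UNIV b i * k i * b i" by (intro mult_le_mono1 n_le)
    also have "\<dots> = k i * (h * B)" by (simp add: B_def prod_eq_mult_cofactor[of UNIV i])
    finally have "real (n * b i) \<le> real (k i * (h * B))" unfolding of_nat_le_iff .
    then show ?thesis using h_pos B_pos by (simp add: divide_le_eq)
  qed
  then have "(\<Prod>i\<in>(UNIV::'d set). real n * real (b i) / (real h * real B)) \<le> (\<Prod>i\<in>UNIV. real (k i))"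
    by (intro prod_mono) auto
  then have prod_k: "real n ^ CARD('d) * real B / (real h * real B) ^ CARD('d) \<le> (\<Prod>i\<in>UNIV. real (k i))"
    by (simp add: prod_dividef prod.distrib B_def)
  have "(real n / (2 * real h * real B)) ^ CARD('d) / 2 =
      real n ^ CARD('d) * real B / (real h * real B) ^ CARD('d) / (2 ^ (CARD('d) + 1) * real B)"
    using B_pos by (simp add: power_divide power_mult_distrib)
  also have "\<dots> \<le> (\<Prod>i\<in>UNIV. real (k i)) / (2 ^ (CARD('d) + 1) * real B)"
    using prod_k by (rule divide_right_mono) simp
  finally show ?thesis unfolding B_def .
qed

locale halton_bases =
  fixes p :: "'d::finite \<Rightarrow> nat \<Rightarrow> nat" and \<sigma> :: "'d \<Rightarrow> nat \<Rightarrow> nat \<Rightarrow> nat"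
  assumes base_ge_2: "j \<ge> 1 \<Longrightarrow> p i j \<ge> 2"
    and scramble_perm: "j \<ge> 1 \<Longrightarrow> bij_betw (\<sigma> i j) {0..p i j - 1} {0..p i j - 1}"
    and coprime_bases: "i \<noteq> l \<Longrightarrow> a \<ge> 1 \<Longrightarrow> b \<ge> 1 \<Longrightarrow> coprime (p i a) (p l b)"
begin

sublocale coord: scrambled_base "p i" "\<sigma> i" for i
  by unfold_locales (use base_ge_2 scramble_perm in auto)

abbreviation P :: "'d \<Rightarrow> nat \<Rightarrow> nat" where
  "P i \<equiv> cantor_prod (p i)"

abbreviation orbit :: "real ^ 'd \<Rightarrow> nat \<Rightarrow> real ^ 'd" where
  "orbit x n \<equiv> halton p \<sigma> n x"

definition peak :: "real ^ 'd \<Rightarrow> nat \<Rightarrow> real" where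
  "peak x N = Max ((\<lambda>M. real M * star_discrepancy (orbit x) M) ` {1..N})"

definition corner :: "('d \<Rightarrow> nat set) \<Rightarrow> real ^ 'd" where
  "corner S = (\<chi> i. \<Sum>j\<in>S i. 1 / real (P i j))"

definition cell_modulus :: "('d \<Rightarrow> nat) \<Rightarrow> nat" where
  "cell_modulus k = (\<Prod>i\<in>UNIV. P i (k i))"

definition cell_base :: "('d \<Rightarrow> nat) \<Rightarrow> nat" where
  "cell_base k = (\<Prod>i\<in>UNIV. p i (k i))"

definition cell_hit :: "('d \<Rightarrow> nat) \<Rightarrow> nat \<Rightarrow> bool" where
  "cell_hit k t \<longleftrightarrow> (\<forall>i. coord.hits i (k i) t)"

lemma coprime_P: "i \<noteq> j \<Longrightarrow> coprime (P i a) (P j b)"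
  unfolding cantor_prod_def by (intro prod_coprime_left prod_coprime_right coprime_bases) auto

lemma cell_modulus_pos: "cell_modulus k > 0"
  by (simp add: cell_modulus_def)

lemma cell_modulus_eq:
  assumes "\<And>i. k i \<ge> 1"
  shows "cell_modulus k = cell_base k * cell_modulus (\<lambda>i. k i - 1)"
  unfolding cell_modulus_def cell_base_def prod.distrib[symmetric]
  using assms by (intro prod.cong) (auto simp: cantor_prod_eq_mult mult.commute)

abbreviation box_discrepancy :: "('d \<Rightarrow> bool) \<Rightarrow> ('d \<Rightarrow> nat set) \<Rightarrow> real ^ 'd \<Rightarrow> nat \<Rightarrow> real" where
  "box_discrepancy w S x \<equiv> mixed_discrepancy w (corner S) (orbit x)"

lemma abs_mixed_discrepancy_le_peak:
  assumes "\<And>i. y $ i \<in> {0<..<1}" "M \<le> N" "N \<ge> 1"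
  shows "\<bar>mixed_discrepancy w y (orbit x) M\<bar> \<le> peak x N"
proof -
  have le_peak: "\<bar>mixed_discrepancy w y (orbit x) M\<bar> \<le> peak x N" if "M \<in> {1..N}" for M
  proof -
    have "real M * star_discrepancy (orbit x) M \<le> peak x N"
      unfolding peak_def using that by (intro Max_ge) auto
    then show ?thesis
      using abs_mixed_discrepancy_le_star[OF assms(1), of w "orbit x" M] by linarith
  qed
  show ?thesis
  proof (cases "M = 0")
    case True
    then show ?thesis using le_peak[of 1] assms(3) by (simp add: mixed_discrepancy_def)
  qed (use le_peak assms(2) in auto)
qed

lemma corner_in_unit:
  assumes "\<And>i. S i \<subseteq> {1..n}" "\<And>i. S i \<noteq> {}"
  shows "corner S $ i \<in> {0<..<1}"
  using coord.sum_inverse_P_less_1[OF assms(1)] assms finite_subset[OF assms(1)]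
  by (auto simp: corner_def intro!: sum_pos)

lemma prod_corner:
  assumes "\<And>i. finite (S i)"
  shows "(\<Prod>i\<in>UNIV. corner S $ i) = (\<Sum>k\<in>PiE UNIV S. 1 / real (cell_modulus k))"
  unfolding corner_def vec_lambda_beta cell_modulus_def
  using assms by (simp add: prod_sum_PiE prod_dividef)

lemma box_hits_obtains:
  assumes x_in_cube: "x \<in> unit_cube" and positions: "\<And>i. S i \<subseteq> {1..n}"
  obtains w M\<^sub>0 where "M\<^sub>0 < cell_modulus (\<lambda>_. n)"
    "\<And>t. indicator (mixed_box w (corner S)) (orbit x (M\<^sub>0 + t)) =
      (\<Sum>k\<in>PiE UNIV S. of_bool (cell_hit k t) :: real)"
proof -
  define hits_from where "hits_from i incl Z \<longleftrightarrow> (\<forall>M t. [M = Z] (mod P i n) \<longrightarrow>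
      indicator (initial_segment incl (corner S $ i)) (orbit x (M + t) $ i) =
      (\<Sum>j\<in>S i. of_bool (coord.hits i j t) :: real))" for i incl Z
  have "\<exists>incl Z. hits_from i incl Z" for i
  proof -
    have "x $ i \<in> {0..<1}" using x_in_cube by (simp add: unit_cube_def)
    from coord.orbit_hits_obtains[OF this positions] show ?thesis
      unfolding hits_from_def halton_nth corner_def vec_lambda_beta by metis
  qed
  then obtain w Z where hits_from_Z: "\<And>i. hits_from i (w i) (Z i)" by metis
  have "\<exists>!M. M < cell_modulus (\<lambda>_. n) \<and> (\<forall>i\<in>UNIV. [M = Z i] (mod P i n))"
    unfolding cell_modulus_def using coprime_P by (intro chinese_remainder_unique_nat) auto
  then obtain M\<^sub>0 where start: "M\<^sub>0 < cell_modulus (\<lambda>_. n)" "\<And>i. [M\<^sub>0 = Z i] (mod P i n)" by auto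
  have "indicator (mixed_box w (corner S)) (orbit x (M\<^sub>0 + t)) =
      (\<Sum>k\<in>PiE UNIV S. of_bool (cell_hit k t) :: real)" for t
  proof -
    have "indicator (mixed_box w (corner S)) (orbit x (M\<^sub>0 + t)) =
        (\<Prod>i\<in>UNIV. indicator (initial_segment (w i) (corner S $ i)) (orbit x (M\<^sub>0 + t) $ i) :: real)"
      by (simp add: mixed_box_def indicator_def of_bool_all_eq_prod)
    also have "\<dots> = (\<Prod>i\<in>UNIV. \<Sum>j\<in>S i. of_bool (coord.hits i j t))"
      using hits_from_Z start(2) unfolding hits_from_def by (intro prod.cong refl) blast
    also have "\<dots> = (\<Sum>k\<in>PiE UNIV S. \<Prod>i\<in>UNIV. of_bool (coord.hits i (k i) t))"
      using finite_subset[OF positions] by (intro prod_sum_PiE) auto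
    finally show ?thesis unfolding cell_hit_def of_bool_all_eq_prod .
  qed
  then show ?thesis using start(1) that by blast
qed

subsection \<open>Residues of the cells\<close>

abbreviation cell_cofactor :: "('d \<Rightarrow> nat) \<Rightarrow> 'd \<Rightarrow> nat" where
  "cell_cofactor k \<equiv> cofactor UNIV (\<lambda>l. P l (k l - 1))"

definition is_cell_residue :: "('d \<Rightarrow> nat) \<Rightarrow> nat \<Rightarrow> bool" where
  "is_cell_residue k r \<longleftrightarrow> r < cell_base k \<and>
     (\<forall>i. [int (r * cell_cofactor k i) = coord.digit_shift i (k i)] (mod int (p i (k i))))"

definition cell_residue :: "('d \<Rightarrow> nat) \<Rightarrow> nat" where
  "cell_residue k = (SOME r. is_cell_residue k r)"

definition cell_deviation :: "('d \<Rightarrow> nat) \<Rightarrow> real" where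
  "cell_deviation k = 1/2 - real (cell_residue k) / real (cell_base k)"

context
  fixes k :: "'d \<Rightarrow> nat"
  assumes k_ge_1: "\<And>i. k i \<ge> 1"
begin

lemma coprime_cell_factors:
  "i \<noteq> j \<Longrightarrow> coprime (P i (k i - 1) * p i (k i)) (P j (k j - 1) * p j (k j))"
  using coprime_P[of i j "k i" "k j"] cantor_prod_eq_mult[OF k_ge_1] by metis

lemma is_cell_residue_cell_residue: "is_cell_residue k (cell_residue k)"
proof (rule cofactor_residue_obtains[of UNIV "\<lambda>i. p i (k i)" "\<lambda>i. P i (k i - 1)"
      "\<lambda>i. coord.digit_shift i (k i)"])
  show "p i (k i) > 0" for i using base_ge_2[OF k_ge_1, of i i] by simp
  show "coprime (P i (k i - 1) * p i (k i)) (P j (k j - 1) * p j (k j))" if "i \<noteq> j" for i j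
    using that by (rule coprime_cell_factors)
  fix r
  assume "r < (\<Prod>i\<in>UNIV. p i (k i))"
    and "\<And>i. i \<in> UNIV \<Longrightarrow>
      [int (r * cell_cofactor k i) = coord.digit_shift i (k i)] (mod int (p i (k i)))"
  then have "is_cell_residue k r" by (simp add: is_cell_residue_def cell_base_def)
  then show ?thesis unfolding cell_residue_def by (rule someI)
qed simp

lemma cell_residue_less: "cell_residue k < cell_base k"
  using is_cell_residue_cell_residue by (simp add: is_cell_residue_def)

lemma cell_residue_cong:
  "[int (cell_residue k * cell_cofactor k i) = coord.digit_shift i (k i)] (mod int (p i (k i)))"
  using is_cell_residue_cell_residue unfolding is_cell_residue_def by blast

lemma not_dvd_cell_residue: "\<not> p i (k i) dvd cell_residue k"
proof
  assume "p i (k i) dvd cell_residue k"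
  then have "int (p i (k i)) dvd int (cell_residue k * cell_cofactor k i)"
    unfolding of_nat_dvd_iff by (rule dvd_mult2)
  then have "int (p i (k i)) dvd coord.digit_shift i (k i)"
    using cong_dvd_iff[OF cell_residue_cong] by blast
  then show False using coord.not_dvd_digit_shift[OF k_ge_1] by blast
qed

lemma cell_hit_iff:
  "cell_hit k t \<longleftrightarrow> [t = cell_residue k * cell_modulus (\<lambda>i. k i - 1)] (mod cell_modulus k)"
  using cong_cofactor_iff[of UNIV "\<lambda>i. P i (k i - 1)" "\<lambda>i. p i (k i)" "cell_residue k"
      "\<lambda>i. coord.digit_shift i (k i)" t] coprime_cell_factors cell_residue_cong
  unfolding cell_hit_def coord.hits_def cell_modulus_def
  by (simp add: cantor_prod_eq_mult[OF k_ge_1] del: of_nat_mult)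

lemma cell_residue_average:
  assumes "cell_modulus k dvd m"
  shows "(\<Sum>M=1..m. \<Sum>t=1..M. of_bool (cell_hit k t) - 1 / real (cell_modulus k)) =
    real m * (cell_deviation k + 1 / (2 * real (cell_modulus k)))"
proof -
  let ?A = "cell_residue k * cell_modulus (\<lambda>i. k i - 1)"
  have "cell_residue k > 0"
    using not_dvd_cell_residue by (metis dvd_0_right gr0I)
  then have "?A \<in> {1..cell_modulus k}"
    unfolding cell_modulus_eq[OF k_ge_1]
    using cell_residue_less cell_modulus_pos by (simp add: Suc_le_eq)
  from residue_class_average[OF this assms] show ?thesis
    unfolding cell_hit_iff[symmetric] using cell_modulus_pos[of "\<lambda>i. k i - 1"]
    by (simp add: cell_deviation_def cell_modulus_eq[OF k_ge_1])
qed

end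

lemma sum_discrepancy_increments_obtains:
  fixes x S n
  assumes x_in_cube: "x \<in> unit_cube" and positions: "\<And>i. S i \<subseteq> {1..n}"
  defines "m \<equiv> cell_modulus (\<lambda>_. n)"
  obtains w M\<^sub>0 where "M\<^sub>0 < m"
    "(\<Sum>M=1..m. box_discrepancy w S x (M\<^sub>0 + M) - box_discrepancy w S x M\<^sub>0) =
     real m * (\<Sum>k\<in>PiE UNIV S. cell_deviation k + 1 / (2 * real (cell_modulus k)))"
proof -
  obtain w M\<^sub>0 where start: "M\<^sub>0 < m"
    "\<And>t. indicator (mixed_box w (corner S)) (orbit x (M\<^sub>0 + t)) =
      (\<Sum>k\<in>PiE UNIV S. of_bool (cell_hit k t) :: real)"
    using box_hits_obtains[of x S n, OF x_in_cube positions] unfolding m_def by blast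
  have "box_discrepancy w S x (M\<^sub>0 + M) - box_discrepancy w S x M\<^sub>0 =
      (\<Sum>k\<in>PiE UNIV S. \<Sum>t=1..M. of_bool (cell_hit k t) - 1 / real (cell_modulus k))" for M
  proof -
    have "box_discrepancy w S x (M\<^sub>0 + M) - box_discrepancy w S x M\<^sub>0 =
        (\<Sum>t=1..M. indicator (mixed_box w (corner S)) (orbit x (M\<^sub>0 + t)) - (\<Prod>i\<in>UNIV. corner S $ i))"
      by (induction M) (auto simp: mixed_discrepancy_def)
    also have "\<dots> = (\<Sum>k\<in>PiE UNIV S. \<Sum>t=1..M. of_bool (cell_hit k t) - 1 / real (cell_modulus k))"
      using prod_corner[of S] finite_subset[OF positions]
      unfolding start(2) by (subst sum.swap) (auto simp: sum_subtractf)
    finally show ?thesis .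
  qed
  then have "(\<Sum>M=1..m. box_discrepancy w S x (M\<^sub>0 + M) - box_discrepancy w S x M\<^sub>0) =
      (\<Sum>k\<in>PiE UNIV S. \<Sum>M=1..m. \<Sum>t=1..M. of_bool (cell_hit k t) - 1 / real (cell_modulus k))"
    by (simp only: sum.swap[of _ _ "{1..m}"])
  also have "\<dots> = (\<Sum>k\<in>PiE UNIV S. real m * (cell_deviation k + 1 / (2 * real (cell_modulus k))))"
  proof (intro sum.cong refl cell_residue_average)
    fix k assume "k \<in> PiE UNIV S"
    then have "k i \<in> S i" for i by (simp add: PiE_iff)
    then have k_range: "k i \<in> {1..n}" for i using positions by blast
    then show "k i \<ge> 1" for i by simp
    show "cell_modulus k dvd m"
      unfolding m_def cell_modulus_def using k_range by (intro prod_dvd_prod cantor_prod_dvd) auto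
  qed
  finally show ?thesis
    using start(1) that by (simp only: sum_distrib_left)
qed

lemma abs_sum_cell_deviation_le_peak:
  assumes x_in_cube: "x \<in> unit_cube" and positions: "\<And>i. S i \<subseteq> {1..n}" "\<And>i. S i \<noteq> {}"
    and N_ge: "2 * cell_modulus (\<lambda>_. n) \<le> N"
  shows "\<bar>\<Sum>k\<in>PiE UNIV S. cell_deviation k\<bar> \<le> 2 * peak x N + 1/2"
proof -
  define m where "m = cell_modulus (\<lambda>_. n)"
  have m_pos: "m > 0" by (simp add: m_def cell_modulus_pos)
  have corner_bounds: "corner S $ i \<in> {0<..<1}" for i using positions by (rule corner_in_unit)
  let ?W = "\<Sum>k\<in>PiE UNIV S. cell_deviation k"
  let ?V = "\<Sum>k\<in>PiE UNIV S. 1 / real (cell_modulus k)"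
  obtain w M\<^sub>0 where start: "M\<^sub>0 < m" and average_eq:
    "(\<Sum>M=1..m. box_discrepancy w S x (M\<^sub>0 + M) - box_discrepancy w S x M\<^sub>0) =
     real m * (\<Sum>k\<in>PiE UNIV S. cell_deviation k + 1 / (2 * real (cell_modulus k)))"
    using sum_discrepancy_increments_obtains[of x S n, OF x_in_cube positions(1)]
    unfolding m_def by blast
  have "\<bar>box_discrepancy w S x (M\<^sub>0 + M) - box_discrepancy w S x M\<^sub>0\<bar> \<le> 2 * peak x N"
    if "M \<in> {1..m}" for M
  proof -
    have "M\<^sub>0 + M \<le> N" "M\<^sub>0 \<le> N" "N \<ge> 1" using that start N_ge by (auto simp: m_def)
    then show ?thesis
      using abs_mixed_discrepancy_le_peak[OF corner_bounds, of "M\<^sub>0 + M" N w x]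
        abs_mixed_discrepancy_le_peak[OF corner_bounds, of M\<^sub>0 N w x] by linarith
  qed
  then have "\<bar>\<Sum>M=1..m. box_discrepancy w S x (M\<^sub>0 + M) - box_discrepancy w S x M\<^sub>0\<bar> \<le>
      (\<Sum>M=1..m. 2 * peak x N)"
    by (intro order_trans[OF sum_abs] sum_mono)
  then have "real m * \<bar>?W + ?V / 2\<bar> \<le> real m * (2 * peak x N)"
    unfolding average_eq abs_mult by (simp add: sum.distrib sum_divide_distrib mult.commute)
  then have "\<bar>?W + ?V / 2\<bar> \<le> 2 * peak x N" using m_pos by simp
  moreover have "(\<Prod>i\<in>UNIV. corner S $ i) = ?V"
    using finite_subset[OF positions(1)] by (intro prod_corner) auto
  then have "0 \<le> ?V" "?V \<le> 1"
    using corner_bounds prod_nonneg[of UNIV "\<lambda>i. corner S $ i"] prod_le_1[of UNIV "\<lambda>i. corner S $ i"]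
    by (auto simp: less_imp_le)
  ultimately show ?thesis by linarith
qed

subsection \<open>Homogeneous positions\<close>

definition homogeneous :: "('d \<Rightarrow> nat) \<Rightarrow> ('d \<Rightarrow> nat set) \<Rightarrow> bool" where
  "homogeneous b J \<longleftrightarrow> (\<forall>i. \<forall>j\<in>J i. j \<ge> 1 \<and> p i j = b i) \<and>
     (\<forall>i. \<forall>j\<in>J i. \<forall>j'\<in>J i. [P i j = P i j'] (mod cofactor UNIV b i))"

lemma homogeneousD:
  assumes "homogeneous b J" "k \<in> PiE UNIV J"
  shows "k i \<ge> 1" "p i (k i) = b i"
  using assms by (auto simp: homogeneous_def PiE_iff)

lemma cell_residue_cong_coordinate:
  assumes homogeneous: "homogeneous b J" and cells: "k \<in> PiE UNIV J" "k' \<in> PiE UNIV J" "k i = k' i"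
  shows "[cell_residue k = cell_residue k'] (mod b i)"
proof -
  let ?U = "\<lambda>k. cell_cofactor k i" and ?V = "\<lambda>k. cofactor UNIV (\<lambda>l. P l (k l)) i"
  have V_eq: "?V k = ?U k * cofactor UNIV b i" if "k \<in> PiE UNIV J" for k
    unfolding cofactor_def prod.distrib[symmetric]
    using homogeneousD[OF homogeneous that] by (intro prod.cong) (auto simp: cantor_prod_eq_mult)
  have "[int (cell_residue k * ?U k) = int (cell_residue k' * ?U k')] (mod int (b i))"
    using cell_residue_cong[of k i] cell_residue_cong[of k' i] homogeneousD[OF homogeneous] cells
    by (simp add: cong_def)
  then have "[cell_residue k * ?U k = cell_residue k' * ?U k'] (mod b i)"
    unfolding cong_int_iff .
  then have "[cell_residue k * ?V k = cell_residue k' * ?V k'] (mod b i)"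
    unfolding V_eq[OF cells(1)] V_eq[OF cells(2)] mult.assoc[symmetric] by (rule cong_scalar_right)
  also have "[cell_residue k' * ?V k' = cell_residue k' * ?V k] (mod b i)"
    unfolding cofactor_def
  proof (intro cong_mult cong_refl cong_prod)
    fix l assume l_neq: "l \<in> UNIV - {i}"
    have "[P l (k' l) = P l (k l)] (mod cofactor UNIV b l)"
      using homogeneous cells by (auto simp: homogeneous_def PiE_iff)
    then show "[P l (k' l) = P l (k l)] (mod b i)"
      by (rule cong_dvd_modulus_nat) (use l_neq in \<open>auto simp: cofactor_def intro: dvd_prodI\<close>)
  qed
  finally show ?thesis
  proof (rule iffD1[OF cong_mult_rcancel_nat, rotated])
    show "coprime (?V k) (b i)"
      unfolding homogeneousD(2)[OF homogeneous cells(1), symmetric] cofactor_def cantor_prod_def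
      using homogeneousD(1)[OF homogeneous cells(1)] by (intro prod_coprime_left coprime_bases) auto
  qed
qed

lemma residue_family_obtains:
  assumes "CARD('d) \<ge> 2" and homogeneous: "homogeneous b J"
    and positions: "\<And>i. finite (J i)" "\<And>i. J i \<noteq> {}"
  obtains c where "residue_family b J cell_residue c"
proof -
  have "PiE UNIV J \<noteq> {}" using positions(2) by (simp add: PiE_eq_empty_iff)
  then obtain k\<^sub>0 where k\<^sub>0_in: "k\<^sub>0 \<in> PiE UNIV J" by blast
  note base_at = homogeneousD[OF homogeneous]
  have update_in: "k\<^sub>0(i := j) \<in> PiE UNIV J" if "j \<in> J i" for i j
    using k\<^sub>0_in that by (auto simp: PiE_iff)
  interpret coprime_moduli b
  proof
    show "b i \<ge> 2" for i
      using base_ge_2[OF base_at(1)[OF k\<^sub>0_in], of i i] unfolding base_at(2)[OF k\<^sub>0_in] .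
    show "coprime (b i) (b j)" if "i \<noteq> j" for i j
      using coprime_bases[OF that base_at(1)[OF k\<^sub>0_in] base_at(1)[OF k\<^sub>0_in], of i j]
      unfolding base_at(2)[OF k\<^sub>0_in] .
  qed (rule assms(1))
  have "residue_family b J cell_residue (\<lambda>i j. cell_residue (k\<^sub>0(i := j)) mod b i)"
  proof
    show "cell_residue k < Q" if "k \<in> PiE UNIV J" for k
      using cell_residue_less[of k] base_at[OF that] by (simp add: Q_def cell_base_def)
    show "cell_residue k mod b i = cell_residue (k\<^sub>0(i := k i)) mod b i" if "k \<in> PiE UNIV J" for k i
    proof -
      have "k i \<in> J i" using that by (simp add: PiE_iff)
      from cell_residue_cong_coordinate[OF homogeneous that update_in[OF this], of i] show ?thesis
        by (simp add: cong_def)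
    qed
    show "cell_residue (k\<^sub>0(i := j)) mod b i \<noteq> 0" if "j \<in> J i" for i j
      using not_dvd_cell_residue[of "k\<^sub>0(i := j)", OF base_at(1)[OF update_in[OF that]], of i]
      unfolding base_at(2)[OF update_in[OF that]] dvd_eq_mod_eq_0 .
  qed (rule positions)+
  then show ?thesis by (rule that)
qed

lemma peak_ge_card_homogeneous:
  assumes x_in_cube: "x \<in> unit_cube" and dimension: "CARD('d) \<ge> 2" and homogeneous: "homogeneous b J"
    and positions: "\<And>i. J i \<subseteq> {1..n}" "\<And>i. J i \<noteq> {}" and N_ge: "2 * cell_modulus (\<lambda>_. n) \<le> N"
  shows "(\<Prod>i\<in>UNIV. real (card (J i))) / (2 ^ (CARD('d) + 1) * real (\<Prod>i\<in>UNIV. b i)) \<le> 2 * peak x N + 1/2"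
proof -
  obtain c where "residue_family b J cell_residue c"
    using residue_family_obtains[OF dimension homogeneous finite_subset[OF positions(1)] positions(2)]
    by blast
  then interpret residue_family b J cell_residue c .
  obtain S where selection: "\<And>i. S i \<subseteq> J i" "\<And>i. S i \<noteq> {}"
    "(\<Prod>i\<in>UNIV. real (card (J i))) / (2 ^ (CARD('d) + 1) * real Q) \<le> \<bar>\<Sum>k\<in>PiE UNIV S. deviation k\<bar>"
    using select_positions_obtains by blast
  have "deviation k = cell_deviation k" if "k \<in> PiE UNIV S" for k
  proof -
    have "k \<in> PiE UNIV J" using that PiE_mono[of UNIV S J] selection(1) by blast
    then have "p i (k i) = b i" for i by (rule homogeneousD(2)[OF homogeneous])
    then show ?thesis by (simp add: deviation_def cell_deviation_def Q_def cell_base_def)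
  qed
  then have "(\<Sum>k\<in>PiE UNIV S. deviation k) =
      (\<Sum>k\<in>PiE UNIV S. cell_deviation k)"
    by (intro sum.cong) auto
  moreover have "S i \<subseteq> {1..n}" for i using selection(1) positions(1) by blast
  then have "\<bar>\<Sum>k\<in>PiE UNIV S. cell_deviation k\<bar> \<le> 2 * peak x N + 1/2"
    using abs_sum_cell_deviation_le_peak[of x S n N] x_in_cube selection(2) N_ge by simp
  ultimately show ?thesis
    using selection(3) unfolding Q_def by linarith
qed

lemma homogeneous_positions_obtains:
  assumes few_bases: "\<And>i. card (p i ` {1..n}) \<le> h" and "n \<ge> 1"
  obtains b J where "homogeneous b J" "\<And>i. J i \<subseteq> {1..n}"
    "\<And>i. n \<le> h * cofactor UNIV b i * card (J i)"
proof -
  have "\<exists>b. card {1..n} \<le> h * card {j\<in>{1..n}. p i j = b}" for i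
    using few_bases by (intro pigeonhole_fiber[of _ "p i ` {1..n}"]) auto
  then obtain b where frequent_base: "\<And>i. n \<le> h * card {j\<in>{1..n}. p i j = b i}"
    unfolding card_atLeastAtMost by (metis diff_Suc_1)
  define D where "D i = {j\<in>{1..n}. p i j = b i}" for i
  have card_D: "n \<le> h * card (D i)" for i
    using frequent_base[of i] by (simp add: D_def)
  have "b i > 0" for i
  proof -
    have "D i \<noteq> {}" using card_D[of i] \<open>n \<ge> 1\<close> by auto
    then obtain j where "j \<ge> 1" "p i j = b i" by (auto simp: D_def)
    then show ?thesis using base_ge_2[of j i] by simp
  qed
  then have cofactor_pos: "cofactor UNIV b i > 0" for i by (simp add: cofactor_def)
  have "\<exists>a. card (D i) \<le> cofactor UNIV b i * card {j\<in>D i. P i j mod cofactor UNIV b i = a}" for i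
    using cofactor_pos[of i]
    by (intro pigeonhole_fiber[of _ "{..<cofactor UNIV b i}"]) (auto simp: D_def)
  then obtain a where frequent_residue: "\<And>i. card (D i) \<le>
      cofactor UNIV b i * card {j\<in>D i. P i j mod cofactor UNIV b i = a i}" by metis
  define J where "J i = {j\<in>D i. P i j mod cofactor UNIV b i = a i}" for i
  have "homogeneous b J"
    unfolding homogeneous_def by (auto simp: J_def D_def cong_def)
  moreover have "J i \<subseteq> {1..n}" for i by (auto simp: J_def D_def)
  moreover have "n \<le> h * cofactor UNIV b i * card (J i)" for i
    using order_trans[OF card_D mult_le_mono2[OF frequent_residue[of i], of h]]
    by (simp add: J_def mult.assoc)
  ultimately show ?thesis using that by blast
qed

lemma peak_ge_power:
  assumes x_in_cube: "x \<in> unit_cube" and dimension: "CARD('d) \<ge> 2"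
    and few_bases: "\<And>i. card (p i ` {1..n}) \<le> h" and base_le: "\<And>i j. j \<ge> 1 \<Longrightarrow> p i j \<le> m"
    and n_ge_1: "n \<ge> 1" and N_ge: "2 * cell_modulus (\<lambda>_. n) \<le> N"
  shows "(real n / (2 * real h * real m ^ CARD('d))) ^ CARD('d) / 2 \<le> 2 * peak x N + 1/2"
proof -
  obtain b J where homogeneous: "homogeneous b J" and positions: "\<And>i. J i \<subseteq> {1..n}"
    and n_le: "\<And>i. n \<le> h * cofactor UNIV b i * card (J i)"
    using homogeneous_positions_obtains[OF few_bases n_ge_1] by blast
  have J_nonempty: "J i \<noteq> {}" for i using n_le[of i] n_ge_1 by auto
  have b_bounds: "b i > 0" "b i \<le> m" for i
  proof -
    obtain j where "j \<in> J i" using J_nonempty by blast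
    then have "j \<ge> 1" "p i j = b i" using homogeneous by (auto simp: homogeneous_def)
    then show "b i > 0" "b i \<le> m" using base_ge_2[of j i] base_le[of j i] by auto
  qed
  have h_pos: "h > 0" using n_le n_ge_1 by (intro gr0I) auto
  have B_pos: "(\<Prod>i\<in>UNIV. b i) > 0" using b_bounds(1) by simp
  have "(\<Prod>i\<in>UNIV. b i) \<le> m ^ CARD('d)"
    using b_bounds(2) prod_mono[of UNIV b "\<lambda>_. m"] by simp
  then have B_le: "real (\<Prod>i\<in>UNIV. b i) \<le> real m ^ CARD('d)"
    unfolding of_nat_power[symmetric] of_nat_le_iff .
  have "real n / (2 * real h * real m ^ CARD('d)) \<le> real n / (2 * real h * real (\<Prod>i\<in>UNIV. b i))"
  proof (rule divide_left_mono)
    show "0 < 2 * real h * real m ^ CARD('d) * (2 * real h * real (\<Prod>i\<in>UNIV. b i))"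
      using h_pos B_pos B_le less_le_trans[of 0 "b undefined" m] b_bounds
      by (intro mult_pos_pos) (simp_all del: of_nat_prod)
  qed (use B_le in \<open>simp_all add: mult_left_mono del: of_nat_prod\<close>)
  then have "(real n / (2 * real h * real m ^ CARD('d))) ^ CARD('d) / 2 \<le>
      (real n / (2 * real h * real (\<Prod>i\<in>UNIV. b i))) ^ CARD('d) / 2"
    by (intro divide_right_mono power_mono) auto
  also have "\<dots> \<le> (\<Prod>i\<in>UNIV. real (card (J i))) / (2 ^ (CARD('d) + 1) * real (\<Prod>i\<in>UNIV. b i))"
    by (rule power_le_prod_div[OF n_le b_bounds(1) h_pos])
  also have "\<dots> \<le> 2 * peak x N + 1/2"
    by (rule peak_ge_card_homogeneous[OF x_in_cube dimension homogeneous positions J_nonempty N_ge])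
  finally show ?thesis .
qed

lemma cell_modulus_const_le:
  assumes "\<And>i j. j \<ge> 1 \<Longrightarrow> p i j \<le> m"
  shows "cell_modulus (\<lambda>_. n) \<le> m ^ (n * CARD('d))"
proof -
  have "P i n \<le> m ^ n" for i
    using prod_mono[of "{1..n}" "p i" "\<lambda>_. m"] assms by (simp add: cantor_prod_def)
  then show ?thesis
    using prod_mono[of UNIV "\<lambda>i. P i n" "\<lambda>_. m ^ n"] by (simp add: cell_modulus_def power_mult)
qed

end

subsection \<open>Choice of the number of positions\<close>

lemma mult_log_2_ge_1:
  fixes m s :: nat
  assumes "m \<ge> 2" "s \<ge> 1"
  shows "1 \<le> real s * log 2 (real m)"
proof -
  have "1 \<le> log 2 (real m)" using assms(1) by (simp add: le_log_iff)
  then show ?thesis using mult_mono[of 1 "real s" 1 "log 2 (real m)"] assms(2) by simp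
qed

lemma power_positions_obtains:
  fixes m s N :: nat
  assumes "m \<ge> 2" "s \<ge> 1" "N \<ge> 2"
  obtains n where "log 2 N / (real s * log 2 m) - 2 \<le> real n" "2 * m ^ (n * s) \<le> N"
proof -
  define L where "L = log 2 (real N)"
  define c where "c = real s * log 2 m"
  define n where "n = nat \<lfloor>(L - 1) / c\<rfloor>"
  have c_ge_1: "c \<ge> 1" unfolding c_def using assms(1,2) by (rule mult_log_2_ge_1)
  have L_ge_1: "L \<ge> 1" unfolding L_def using assms(3) by (simp add: le_log_iff)
  have "L / c - 2 \<le> (L - 1) / c - 1" using c_ge_1 by (simp add: diff_divide_distrib)
  also have "\<dots> \<le> real n" unfolding n_def by linarith
  finally have n_ge: "L / c - 2 \<le> real n" .
  have "real n \<le> (L - 1) / c" unfolding n_def using L_ge_1 c_ge_1 by (simp add: of_nat_nat)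
  then have "1 + real n * c \<le> L" using c_ge_1 by (simp add: pos_le_divide_eq)
  moreover have "log 2 (real (2 * m ^ (n * s))) = 1 + real n * c"
    using assms(1) by (simp add: log_mult log_nat_power c_def)
  ultimately have "log 2 (real (2 * m ^ (n * s))) \<le> log 2 (real N)"
    by (simp only: L_def)
  then have "real (2 * m ^ (n * s)) \<le> real N"
    by (rule iffD1[OF log_le_cancel_iff, rotated -1]) (use assms in auto)
  then show ?thesis using n_ge that unfolding of_nat_le_iff L_def c_def by blast
qed

lemma ge_2_of_log_2_neq_0:
  assumes "log 2 (real N) \<noteq> 0"
  shows "N \<ge> 2"
proof (rule ccontr)
  assume "\<not> N \<ge> 2"
  then have "N = 0 \<or> N = 1" by linarith
  with assms show False by (auto simp: log_def)
qed

lemma mult_power_ge_8: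
  fixes h m s :: nat
  assumes "h \<ge> 1" "m \<ge> 2" "s \<ge> 2"
  shows "8 \<le> 2 * real h * real m ^ s"
proof -
  have "4 \<le> real m ^ 2" using power_mono[of 2 "real m" 2] assms(2) by simp
  also have "\<dots> \<le> real m ^ s" using assms(2,3) by (intro power_increasing) auto
  finally show ?thesis using mult_mono[of 1 "real h" 4 "real m ^ s"] assms(1) by simp
qed

lemma power_minus_quarter_ge:
  fixes z :: real
  assumes "2 ^ s \<le> z"
  shows "7/8 * z ^ s \<le> (z - 1/4) ^ s"
proof -
  have z_ge_1: "1 \<le> z" using assms one_le_power[of "2::real" s] by linarith
  have "2 * real s \<le> 2 ^ s"
    using less_exp[of "s - 1"] by (cases s) (simp_all add: nat_less_real_le)
  then have "7/8 \<le> 1 + real s * (- (1 / (4 * z)))"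
    using assms z_ge_1 by (simp add: field_simps)
  also have "\<dots> \<le> (1 + - (1 / (4 * z))) ^ s"
    using z_ge_1 by (intro Bernoulli_inequality) (simp add: field_simps)
  finally have "7/8 * z ^ s \<le> (1 + - (1 / (4 * z))) ^ s * z ^ s"
    using z_ge_1 by (intro mult_right_mono) auto
  also have "\<dots> = ((1 + - (1 / (4 * z))) * z) ^ s"
    by (rule power_mult_distrib[symmetric])
  also have "(1 + - (1 / (4 * z))) * z = z - 1/4"
    using z_ge_1 by (simp add: field_simps)
  finally show ?thesis .
qed

lemma power_2_le_quotient:
  fixes m s :: nat and C L :: real
  assumes "m \<ge> 2" "s \<ge> 1" "C > 0" "2 * real m ^ (s - 1) * C \<le> L"
  shows "2 ^ s \<le> L / C"
proof -
  have "(2::real) ^ s = 2 * 2 ^ (s - 1)"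
    using assms(2) by (simp flip: power_Suc)
  also have "\<dots> \<le> 2 * real m ^ (s - 1)"
    using assms(1) by (intro mult_left_mono power_mono) auto
  also have "\<dots> \<le> L / C" using assms(3,4) by (simp add: le_divide_eq)
  finally show ?thesis .
qed

lemma (in halton_bases) peak_ge_log_power:
  fixes s h m N :: nat and C :: real
  assumes x_in_cube: "x \<in> unit_cube" and dimension: "s = CARD('d)" "s \<ge> 2"
    and few_bases: "\<And>i n. card (p i ` {1..n}) \<le> h" and base_le: "\<And>i j. j \<ge> 1 \<Longrightarrow> p i j \<le> m"
    and C_formula: "C = 2 * real s * real h * real m ^ s * log 2 (real m)"
    and N_ge: "2 * real m ^ (s - 1) * C \<le> log 2 (real N)"
  shows "(log 2 (real N) / C) ^ s / 8 \<le> peak x N"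
proof -
  define c where "c = real s * log 2 (real m)"
  define a where "a = 2 * real h * real m ^ s"
  define z where "z = log 2 (real N) / C"
  have m_ge: "m \<ge> 2" using base_ge_2[of 1 undefined] base_le[of 1 undefined] by simp
  have h_ge: "h \<ge> 1" using few_bases[of undefined 1] by simp
  have c_ge: "c \<ge> 1" unfolding c_def using m_ge dimension(2) by (intro mult_log_2_ge_1) auto
  have a_ge: "a \<ge> 8" unfolding a_def using h_ge m_ge dimension(2) by (rule mult_power_ge_8)
  have C_eq: "C = a * c" by (simp add: C_formula a_def c_def)
  then have C_pos: "C > 0" using a_ge c_ge by simp
  have z_ge: "2 ^ s \<le> z"
    unfolding z_def using m_ge dimension(2) C_pos N_ge by (intro power_2_le_quotient) auto
  have "4 \<le> (2::real) ^ s"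
    using power_increasing[of 2 s "2::real"] dimension(2) by simp
  then have z_ge_4: "4 \<le> z" using z_ge by linarith
  have log_N: "log 2 (real N) / c = a * z" using c_ge a_ge by (simp add: z_def C_eq)
  have az_ge: "32 \<le> a * z" using mult_mono[OF a_ge, of 4 z] z_ge_4 a_ge by simp
  then have "N \<ge> 2" using log_N by (intro ge_2_of_log_2_neq_0) auto
  then obtain n where "log 2 N / c - 2 \<le> real n" and power_le: "2 * m ^ (n * s) \<le> N"
    using power_positions_obtains[OF m_ge, of s N] dimension(2) unfolding c_def by auto
  then have n_ge: "a * z - 2 \<le> real n" by (simp add: log_N)
  then have "n \<ge> 1" using az_ge by linarith
  moreover have "2 * cell_modulus (\<lambda>_. n) \<le> N"
    using cell_modulus_const_le[OF base_le, of n] power_le unfolding dimension(1) by linarith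
  ultimately have "(real n / a) ^ s / 2 \<le> 2 * peak x N + 1/2"
    unfolding a_def dimension(1) using dimension
    by (intro peak_ge_power x_in_cube few_bases base_le) auto
  moreover have "(z - 1/4) ^ s \<le> (real n / a) ^ s"
  proof (rule power_mono)
    have "z - 1/4 \<le> (a * z - 2) / a" using a_ge by (simp add: field_simps)
    also have "\<dots> \<le> real n / a" using n_ge a_ge by (intro divide_right_mono) auto
    finally show "z - 1/4 \<le> real n / a" .
  qed (use z_ge_4 in linarith)
  moreover have "4 \<le> z ^ s"
    using power_increasing[of 1 s z] dimension(2) z_ge_4 by simp
  ultimately show ?thesis
    using power_minus_quarter_ge[OF z_ge] unfolding z_def[symmetric] by linarith
qed

lemma halton_bases_of_finite_choice:
  fixes h :: "'d::finite \<Rightarrow> nat" and q p :: "'d \<Rightarrow> nat \<Rightarrow> nat"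
  assumes entry_ge_2: "\<And>i k. k \<in> {1..h i} \<Longrightarrow> q i k \<ge> 2"
    and coprime_entries: "\<And>i j k l. i \<noteq> j \<Longrightarrow> k \<in> {1..h i} \<Longrightarrow> l \<in> {1..h j} \<Longrightarrow> gcd (q i k) (q j l) = 1"
    and base_choice: "\<And>i j. j \<ge> 1 \<Longrightarrow> p i j \<in> q i ` {1..h i}"
    and scramble_perm: "\<And>i j. j \<ge> 1 \<Longrightarrow> bij_betw (\<sigma> i j) {0..p i j - 1} {0..p i j - 1}"
  shows "halton_bases p \<sigma>"
proof
  fix i :: 'd and j :: nat
  assume "j \<ge> 1"
  then show "p i j \<ge> 2" using base_choice[of j i] entry_ge_2[of _ i] by auto
  show "bij_betw (\<sigma> i j) {0..p i j - 1} {0..p i j - 1}" using \<open>j \<ge> 1\<close> by (rule scramble_perm)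
next
  fix i l :: 'd and a b :: nat
  assume "i \<noteq> l" "a \<ge> 1" "b \<ge> 1"
  then show "coprime (p i a) (p l b)"
    using base_choice[of a i] base_choice[of b l] coprime_entries[of i l]
    by (auto simp: coprime_iff_gcd_eq_1)
qed

lemma card_image_le_Max_range:
  fixes h :: "'d::finite \<Rightarrow> nat"
  assumes "\<And>j. j \<ge> 1 \<Longrightarrow> f j \<in> q ` {1..h i}"
  shows "card (f ` {1..n}) \<le> Max (range h)"
proof -
  have "card (f ` {1..n}) \<le> card (q ` {1..h i})" using assms by (intro card_mono) auto
  also have "\<dots> \<le> h i" using card_image_le[of "{1..h i}" q] by simp
  also have "\<dots> \<le> Max (range h)" by (intro Max_ge) auto
  finally show ?thesis .
qed

lemma le_Max_entries:
  fixes h :: "'d::finite \<Rightarrow> nat" and q :: "'d \<Rightarrow> nat \<Rightarrow> nat"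
  assumes "a \<in> q i ` {1..h i}"
  shows "a \<le> Max {q i j | i j. j \<in> {1..h i}}"
proof (rule Max_ge)
  have "{q i j | i j. j \<in> {1..h i}} = (\<Union>i. q i ` {1..h i})" by blast
  then show "finite {q i j | i j. j \<in> {1..h i}}" by simp
qed (use assms in blast)

theorem mainTheorem1:
  fixes s h\<^sub>0 q\<^sub>0 N :: nat
    and h :: "'d::finite \<Rightarrow> nat"
    and q p :: "'d \<Rightarrow> nat \<Rightarrow> nat"
    and \<sigma> :: "'d \<Rightarrow> nat \<Rightarrow> nat \<Rightarrow> nat"
    and C\<^sub>1 C :: real
  assumes "s = CARD('d)" and "s \<ge> 2"
    and "\<And>i. h i \<ge> 1"
    and "\<And>i k. k \<in> {1..h i} \<Longrightarrow> q i k \<ge> 2"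
    and "\<And>i j k l. i \<noteq> j \<Longrightarrow> k \<in> {1..h i} \<Longrightarrow> l \<in> {1..h j} \<Longrightarrow> gcd (q i k) (q j l) = 1"
    and "\<And>i j. j \<ge> 1 \<Longrightarrow> p i j \<in> q i ` {1..h i}"
    and "\<And>i j. j \<ge> 1 \<Longrightarrow> bij_betw (\<sigma> i j) {0..p i j - 1} {0..p i j - 1}"
    and "h\<^sub>0 = Max (range h)"
    and "q\<^sub>0 = Max {q i j | i j. j \<in> {1..h i}}"
    and "C\<^sub>1 = 2 * real s * real h\<^sub>0 * real q\<^sub>0 ^ s * log 2 (real q\<^sub>0)"
    and "C = 2 ^ (s + 3) * real s ^ s * real h\<^sub>0 ^ s * real q\<^sub>0 ^ (s\<^sup>2) * log 2 (real q\<^sub>0) ^ s"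
    and "log 2 (real N) \<ge> 2 * real q\<^sub>0 ^ (s - 1) * C\<^sub>1"
  shows "(INF x\<in>(unit_cube :: (real ^ 'd) set).
            Max ((\<lambda>M. real M * star_discrepancy (\<lambda>n. halton p \<sigma> n x) M) ` {1..N}))
         \<ge> inverse C * log 2 (real N) ^ s"
proof -
  interpret halton_bases p \<sigma>
    using assms(4-7) by (rule halton_bases_of_finite_choice)
  have "C = 8 * C\<^sub>1 ^ s"
    unfolding assms(10,11) by (simp add: power_mult_distrib power_add power2_eq_square power_mult)
  then have "inverse C * log 2 (real N) ^ s = (log 2 (real N) / C\<^sub>1) ^ s / 8"
    by (simp add: power_divide inverse_eq_divide mult.commute)
  also have "\<dots> \<le> peak x N" if "x \<in> unit_cube" for x
  proof (rule peak_ge_log_power[OF that assms(1,2) _ _ assms(10,12)])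
    show "card (p i ` {1..n}) \<le> h\<^sub>0" for i n
      unfolding assms(8) using assms(6) by (rule card_image_le_Max_range)
    show "p i j \<le> q\<^sub>0" if "j \<ge> 1" for i j
      unfolding assms(9) by (rule le_Max_entries[OF assms(6)[OF that]])
  qed
  finally have "inverse C * log 2 (real N) ^ s \<le> peak x N" if "x \<in> unit_cube" for x
    using that by blast
  moreover have "(0 :: real ^ 'd) \<in> unit_cube" by (simp add: unit_cube_def)
  ultimately show ?thesis
    unfolding peak_def by (intro cINF_greatest) auto
qed

end
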